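(* Under Assumption 1 (stated in the context), there exists a threshold $\bar\beta>0$ such that for every $\beta>\bar\beta$, the problem $\inf_{K\in\mathcal{K}_\beta}J_{\mathrm{mix}}(K)$ admits a stationary point, i.e. there exists $K\in\mathcal{K}_\beta$ with $\nabla J_{\mathrm{mix}}(K)=0$.
   Context: Let $A\in\mathbb{R}^{n\times n}$, $B\in\mathbb{R}^{n\times m}$, $B_w\in\mathbb{R}^{n\times n}$, $W:=B_wB_w^{\mathsf T}$. Let $Q_2\succeq0$, $R_2\succ0$, $Q_\infty\succ0$, $R_\infty\succ0$ be fixed symmetric weight matrices, and let $\beta>0$ be the robustness parameter. For $K\in\mathbb{R}^{m\times n}$ write $A_K:=A+BK$, $S_K:=Q_\infty+K^{\mathsf T}R_\infty K$. Let $\mathcal{K}:=\{K: A_K \text{ Hurwitz}\}$, $\mathbf{T}_\infty(K)(s)=\begin{bmatrix}Q_\infty^{1/2}\\ R_\infty^{1/2}K\end{bmatrix}(sI-A_K)^{-1}B_w$, $\mathcal{K}_\beta:=\{K\in\mathcal{K}:\|\mathbf{T}_\infty(K)\|_{\mathcal{H}_\infty}<\beta\}$. For $K\in\mathcal{K}_\beta$ the Riccati equation $A_KX+XA_K^{\mathsf T}+\beta^{-2}XS_KX+W=0$ has a unique stabilizing solution $X_K\succeq0$ (i.e. $A_K+\beta^{-2}X_KS_K$ Hurwitz), and $J_{\mathrm{mix}}(K):=\operatorname{tr}((Q_2+K^{\mathsf T}R_2K)X_K)$, a differentiable function on the open set $\mathcal{K}_\beta$. Assumption 1: $(A,B)$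 stabilizable, $(Q_2^{1/2},A)$ detectable, and $\beta>\inf_{K\in\mathcal{K}}\|\mathbf{T}_\infty(K)\|_{\mathcal{H}_\infty}$. *)

theory Defs
  imports "HOL-Analysis.Analysis"
begin

definition cmat :: "real^'c^'r \<Rightarrow> complex^'c^'r" where
  "cmat M = (\<chi> i j. complex_of_real (M $ i $ j))"

definition hurwitz :: "real^'n^'n \<Rightarrow> bool" where
  "hurwitz M \<longleftrightarrow> (\<forall>z::complex. det (mat z - cmat M) = 0 \<longrightarrow> Re z < 0)"

definition psd :: "real^'n^'n \<Rightarrow> bool" where
  "psd M \<longleftrightarrow> transpose M = M \<and> (\<forall>x. 0 \<le> x \<bullet> (M *v x))"

definition pd :: "real^'n^'n \<Rightarrow> bool" where
  "pd M \<longleftrightarrow> transpose M = M \<and> (\<forall>x. x \<noteq> 0 \<longrightarrow> 0 < x \<bullet> (M *v x))"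

definition psd_sqrt :: "real^'n^'n \<Rightarrow> real^'n^'n" where
  "psd_sqrt M = (THE S. psd S \<and> S ** S = M)"

definition stabilizable :: "real^'n^'n \<Rightarrow> real^'m^'n \<Rightarrow> bool" where
  "stabilizable A B \<longleftrightarrow> (\<exists>K::real^'n^'m. hurwitz (A + B ** K))"

definition detectable :: "real^'n^'p \<Rightarrow> real^'n^'n \<Rightarrow> bool" where
  "detectable C A \<longleftrightarrow> (\<exists>L::real^'p^'n. hurwitz (A + L ** C))"

definition AK :: "real^'n^'n \<Rightarrow> real^'m^'n \<Rightarrow> real^'n^'m \<Rightarrow> real^'n^'n" where
  "AK A B K = A + B ** K"

definition SK :: "real^'n^'n \<Rightarrow> real^'m^'m \<Rightarrow> real^'n^'m \<Rightarrow> real^'n^'n" where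
  "SK Qinf Rinf K = Qinf + transpose K ** Rinf ** K"

definition stabilizing :: "real^'n^'n \<Rightarrow> real^'m^'n \<Rightarrow> (real^'n^'m) set" where
  "stabilizing A B = {K. hurwitz (AK A B K)}"

text \<open>Euclidean norm of T_inf(K)(s) v, where
  T_inf(K)(s) = [Qinf^(1/2); Rinf^(1/2) K] (sI - A_K)^(-1) Bw  (a stacked (n+m) x n matrix):
  the norm of a stacked vector [a; b] is sqrt(|a|^2 + |b|^2).\<close>
definition Tinf_apply ::
  "real^'n^'n \<Rightarrow> real^'m^'n \<Rightarrow> real^'n^'n \<Rightarrow> real^'n^'n \<Rightarrow> real^'m^'m \<Rightarrow> real^'n^'m
    \<Rightarrow> complex \<Rightarrow> complex^'n \<Rightarrow> real" where
  "Tinf_apply A B Bw Qinf Rinf K s v =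
     (let x = matrix_inv (mat s - cmat (AK A B K)) *v (cmat Bw *v v)
      in sqrt ((norm (cmat (psd_sqrt Qinf) *v x))\<^sup>2
             + (norm (cmat (psd_sqrt Rinf ** K) *v x))\<^sup>2))"

text \<open>H-infinity norm: supremum over the imaginary axis of the largest singular value
  (induced 2-norm) of T_inf(K)(i w).\<close>
definition hinf_norm ::
  "real^'n^'n \<Rightarrow> real^'m^'n \<Rightarrow> real^'n^'n \<Rightarrow> real^'n^'n \<Rightarrow> real^'m^'m \<Rightarrow> real^'n^'m \<Rightarrow> real" where
  "hinf_norm A B Bw Qinf Rinf K =
     (SUP p \<in> {(w::real, v::complex^'n). norm v = 1}.
        Tinf_apply A B Bw Qinf Rinf K (\<i> * complex_of_real (fst p)) (snd p))"

definition Kbeta ::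
  "real^'n^'n \<Rightarrow> real^'m^'n \<Rightarrow> real^'n^'n \<Rightarrow> real^'n^'n \<Rightarrow> real^'m^'m \<Rightarrow> real \<Rightarrow> (real^'n^'m) set" where
  "Kbeta A B Bw Qinf Rinf \<beta> = {K \<in> stabilizing A B. hinf_norm A B Bw Qinf Rinf K < \<beta>}"

definition XK ::
  "real^'n^'n \<Rightarrow> real^'m^'n \<Rightarrow> real^'n^'n \<Rightarrow> real^'n^'n \<Rightarrow> real^'m^'m \<Rightarrow> real \<Rightarrow> real^'n^'m
    \<Rightarrow> real^'n^'n" where
  "XK A B Bw Qinf Rinf \<beta> K =
     (THE X. psd X \<and>
        AK A B K ** X + X ** transpose (AK A B K)
          + (inverse (\<beta>\<^sup>2)) *\<^sub>R (X ** SK Qinf Rinf K ** X) + Bw ** transpose Bw = 0 \<and>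
        hurwitz (AK A B K + (inverse (\<beta>\<^sup>2)) *\<^sub>R (X ** SK Qinf Rinf K)))"

definition Jmix ::
  "real^'n^'n \<Rightarrow> real^'m^'n \<Rightarrow> real^'n^'n \<Rightarrow> real^'n^'n \<Rightarrow> real^'m^'m \<Rightarrow> real^'n^'n \<Rightarrow> real^'m^'m
    \<Rightarrow> real \<Rightarrow> real^'n^'m \<Rightarrow> real" where
  "Jmix A B Bw Q2 R2 Qinf Rinf \<beta> K =
     trace ((Q2 + transpose K ** R2 ** K) ** XK A B Bw Qinf Rinf \<beta> K)"

end

theory Submission
  imports Defs "HOL-Computational_Algebra.Fundamental_Theorem_Algebra"
begin

text \<open>
  Put \<open>\<epsilon> = \<beta>\<^sup>-\<^sup>2\<close> and let \<open>Y\<close> solve the adjoint Lyapunov equation of the closed loop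
  \<open>A\<^sub>K + \<epsilon> X S\<^sub>K\<close>. The gradient of \<open>Jmix\<close> is \<open>2 G X\<close> with
  \<open>G = R2 K + B\<^sup>T Y + \<epsilon> Rinf K X Y\<close>, so it suffices to solve \<open>G = 0\<close> together with the Riccati and
  adjoint equations; as \<open>X\<close> need not be invertible, working with \<open>G\<close> instead of the gradient is essential.
  At \<open>\<epsilon> = 0\<close> this system is solved by the LQR optimal gain, where its linearisation in
  \<open>(X, Y, K)\<close> is invertible, so an open mapping theorem yields solutions near the LQR gain for all small
  \<open>\<epsilon>\<close>. The H-infinity norm is bounded near that gain, so these solutions lie in \<open>Kbeta\<close> when
  \<open>\<beta>\<close> is large.
\<close>

subsection \<open>Matrix algebra\<close>

text \<open>The unknowns range over full matrix spaces rather than symmetric ones, so that the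
  residual maps go between spaces of equal dimension and an injective derivative is invertible.
  Symmetry of \<open>X\<close> and \<open>Y\<close> is recovered afterwards: the transpose solves
  the same equation, and a homogeneous Sylvester equation with Hurwitz coefficients has only the
  zero solution. The derivative of \<open>XK\<close> is never computed; \<open>Y\<close> is a
  Lagrange multiplier whose equation makes it drop out, so differentiability is enough. The
  remaining obstacle is uniformity near the LQR gain: one bound for the H-infinity norm, and
  openness of the Hurwitz condition. Both come from a single quadratic form \<open>P\<close> with
  x^T P M x < 0, which tolerates small changes of \<open>M\<close>. It is built algebraically from a
  polynomial annihilating \<open>M\<close>, without matrix exponentials or integrals.\<close>

lemma matrix_add_rdist: "((B::'a::semiring_1^'n^'m) + C) ** A = B ** A + C ** A"
  by (vector matrix_matrix_mult_def sum.distrib[symmetric] field_simps)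

lemma matrix_diff_ldist: "(A::'a::ring_1^'n^'m) ** (B - C) = A ** B - A ** C"
  by (vector matrix_matrix_mult_def sum_subtractf[symmetric] field_simps)

lemma matrix_diff_rdist: "((B::'a::ring_1^'n^'m) - C) ** A = B ** A - C ** A"
  by (vector matrix_matrix_mult_def sum_subtractf[symmetric] field_simps)

lemma matrix_minus_left: "(- (A::'a::ring_1^'n^'m)) ** B = - (A ** B)"
  by (vector matrix_matrix_mult_def sum_negf[symmetric])

lemma matrix_minus_right: "(A::'a::ring_1^'n^'m) ** (- B) = - (A ** B)"
  by (vector matrix_matrix_mult_def sum_negf[symmetric])

lemma transpose_add: "transpose (A + B) = transpose A + transpose B"
  by (vector transpose_def)

lemma transpose_diff: "transpose (A - B) = transpose A - transpose B"
  by (vector transpose_def)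

lemma transpose_minus: "transpose (- A) = - transpose A"
  by (vector transpose_def)

lemma transpose_zero: "transpose 0 = 0"
  by (vector transpose_def)

lemma bounded_bilinear_matrix_mult:
  "bounded_bilinear ((**) :: real^'n^'m \<Rightarrow> real^'p^'n \<Rightarrow> real^'p^'m)"
  by (auto simp: bilinear_conv_bounded_bilinear[symmetric] bilinear_def matrix_add_ldistrib
      matrix_add_rdist matrix_scalar_ac scalar_matrix_assoc[symmetric] intro!: linearI)

lemma bounded_linear_transpose: "bounded_linear (transpose :: real^'n^'m \<Rightarrow> real^'m^'n)"
  by (auto simp: linear_conv_bounded_linear[symmetric] transpose_add transpose_scalar intro!: linearI)

lemma bounded_linear_trace: "bounded_linear (trace :: real^'n^'n \<Rightarrow> real)"
  by (auto simp: linear_conv_bounded_linear[symmetric] trace_add intro!: linearI)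
    (simp add: trace_def sum_distrib_left)

lemmas matrix_distribs = matrix_add_ldistrib matrix_add_rdist matrix_diff_ldist matrix_diff_rdist
  matrix_minus_left matrix_minus_right

lemmas transpose_distribs = transpose_add transpose_diff transpose_minus transpose_scalar
  matrix_transpose_mul transpose_zero

lemma inner_matrix_vector: "x \<bullet> (A *v y) = (transpose A *v x) \<bullet> y" for A :: "real^'n^'m"
  by (simp add: dot_lmul_matrix)

subsection \<open>Annihilating polynomials\<close>

lemma mat_mult_component: "(mat z ** E) $ i $ j = (z::'a::semiring_1) * E $ i $ j"
proof -
  have "(mat z ** E) $ i $ j = (\<Sum>k\<in>UNIV. if k = i then z * E $ i $ j else 0)"
    unfolding matrix_matrix_mult_def mat_def vec_lambda_beta by (rule sum.cong) auto
  then show ?thesis by simp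
qed

lemma mult_mat_component: "(E ** mat z) $ i $ j = E $ i $ j * (z::'a::semiring_1)"
proof -
  have "(E ** mat z) $ i $ j = (\<Sum>k\<in>UNIV. if k = j then E $ i $ j * z else 0)"
    unfolding matrix_matrix_mult_def mat_def vec_lambda_beta by (rule sum.cong) auto
  then show ?thesis by simp
qed

lemma mat_comm: "mat (z::'a::comm_semiring_1) ** E = E ** mat z"
  by (simp add: vec_eq_iff mat_mult_component mult_mat_component mult.commute)

lemma mat_add: "mat (a + b) = mat a + mat (b::'a::comm_ring_1)"
  by (vector mat_def)

lemma mat_minus: "mat (- b) = - mat (b::'a::comm_ring_1)"
  by (vector mat_def)

lemma mat_mult: "mat (a * b) = mat a ** mat (b::'a::comm_ring_1)"
  by (simp add: vec_eq_iff mat_mult_component) (simp add: mat_def)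

lemma mat_mult_vector: "mat (c::'a::comm_ring_1) *v x = c *s x"
proof -
  have "(mat c *v x) $ i = (\<Sum>k\<in>UNIV. if k = i then c * x $ i else 0)" for i
    unfolding matrix_vector_mult_def mat_def vec_lambda_beta by (rule sum.cong) auto
  then show ?thesis by (simp add: vec_eq_iff)
qed

lemma mat_of_real_mult: "mat (complex_of_real c) ** E = c *\<^sub>R E"
  by (simp add: vec_eq_iff mat_mult_component scaleR_conv_of_real[where 'a=complex])

text \<open>Horner evaluation of \<open>p\<close> at the matrix \<open>C\<close>, with scalars
  embedded as \<open>mat a\<close>.\<close>

definition mpoly :: "'a::comm_ring_1^'n^'n \<Rightarrow> 'a poly \<Rightarrow> 'a^'n^'n" where
  "mpoly C p = fold_coeffs (\<lambda>a E. mat a + C ** E) p 0"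

lemma mpoly_0 [simp]: "mpoly C 0 = 0"
  by (simp add: mpoly_def)

lemma mpoly_pCons [simp]: "mpoly C (pCons a p) = mat a + C ** mpoly C p"
  by (cases "p = 0 \<and> a = 0") (auto simp: mpoly_def)

lemma mpoly_add: "mpoly C (p + q) = mpoly C p + mpoly C q"
  by (induction p q rule: poly_induct2) (auto simp: mat_add matrix_distribs)

lemma mpoly_smult: "mpoly C (smult c p) = mat c ** mpoly C p"
  by (induction p) (auto simp: mat_mult matrix_distribs matrix_mul_assoc mat_comm[of c C])

lemma mpoly_sum: "mpoly C (sum f S) = (\<Sum>x\<in>S. mpoly C (f x))"
  by (induction S rule: infinite_finite_induct) (auto simp: mpoly_add)

lemma mpoly_linear_factor: "mpoly C ([:- z, 1:] * p) = (C - mat z) ** mpoly C p"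
proof -
  have "[:- z, 1:] * p = smult (- z) p + pCons 0 p" by simp
  then show ?thesis
    by (simp only: mpoly_add mpoly_smult mpoly_pCons) (simp add: matrix_distribs mat_minus)
qed

text \<open>The powers of \<open>C\<close> live in a space of finite real dimension, so infinitely
  many of them are linearly dependent, even over the reals.\<close>

lemma annihilating_poly:
  fixes C :: "complex^'n^'n"
  shows "\<exists>p. p \<noteq> 0 \<and> mpoly C p = 0"
proof -
  define m where "m k = mpoly C (monom 1 k)" for k :: nat
  show ?thesis
  \<comment> \<open>\<open>dependent\<close> speaks of the set of powers, in which equal powers
    coincide. A repeated power therefore gets its own annihilator, the difference of two
    monomials.\<close>
  proof (cases "inj m")
    case False
    then obtain j k where jk: "j \<noteq> k" "m j = m k"
      by (auto simp: inj_def)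
    have "mpoly C (monom 1 j + smult (-1) (monom 1 k)) = 0"
      using jk by (simp only: mpoly_add mpoly_smult) (simp add: m_def mat_minus matrix_distribs)
    moreover have "monom 1 j + smult (-1) (monom 1 k) \<noteq> (0::complex poly)"
    proof
      assume "monom 1 j + smult (-1) (monom 1 k) = (0::complex poly)"
      then have "coeff (monom 1 j + smult (-1) (monom 1 k)) j = (0::complex)" by simp
      with jk show False by (simp split: if_splits)
    qed
    ultimately show ?thesis by blast
  next
    case True
    then have "infinite (range m)"
      using finite_imageD by blast
    then have "dependent (range m)"
      using independent_bound by blast
    then obtain T u where T: "finite T" "T \<subseteq> range m" "(\<Sum>v\<in>T. u v *\<^sub>R v) = 0" "\<exists>v\<in>T. u v \<noteq> 0"
      unfolding dependent_explicit by blast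
    define S where "S = m -` T"
    have S: "finite S" "T = m ` S"
      using T True by (auto simp: S_def finite_vimageI)
    define p :: "complex poly" where "p = (\<Sum>k\<in>S. smult (of_real (u (m k))) (monom 1 k))"
    have "mpoly C p = (\<Sum>k\<in>S. u (m k) *\<^sub>R m k)"
      by (simp add: p_def mpoly_sum mpoly_smult mat_of_real_mult m_def)
    also have "\<dots> = 0"
      using T(3) S(2) sum.reindex[of m S "\<lambda>v. u v *\<^sub>R v"] True by (simp add: inj_on_def)
    finally have "mpoly C p = 0" .
    moreover have "p \<noteq> 0"
    proof -
      obtain k where k: "k \<in> S" "u (m k) \<noteq> 0"
        using T(4) S by auto
      have "coeff p k = (\<Sum>j\<in>S. if j = k then of_real (u (m j)) else 0)"
        unfolding p_def coeff_sum by (rule sum.cong) auto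
      also have "\<dots> = of_real (u (m k))"
        using k S by simp
      finally show ?thesis using k by auto
    qed
    ultimately show ?thesis by blast
  qed
qed

text \<open>An annihilator in factored form. Keeping the roots as a list allows induction factor by
  factor and discarding roots by \<open>filter\<close>.\<close>

primrec mprod :: "complex^'n^'n \<Rightarrow> complex list \<Rightarrow> complex^'n^'n" where
  "mprod C [] = mat 1"
| "mprod C (z # zs) = (C - mat z) ** mprod C zs"

lemma mprod_comm: "(C - mat z) ** mprod C zs = mprod C zs ** (C - mat z)"
proof (induction zs)
  case (Cons y zs)
  have "(C - mat z) ** (C - mat y) = (C - mat y) ** (C - mat z)"
    by (simp add: matrix_distribs mat_comm[of z] mat_comm[of y C])
  then show ?case
    using Cons by (simp add: matrix_mul_assoc) (simp flip: matrix_mul_assoc)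
qed simp

lemma mpoly_splits: "p \<noteq> 0 \<Longrightarrow> \<exists>c zs. c \<noteq> 0 \<and> mpoly C p = mat c ** mprod C zs"
proof (induction "degree p" arbitrary: p)
  case 0
  then obtain c where "p = [:c:]" by (metis degree_eq_zeroE)
  with 0 show ?case by (intro exI[of _ c] exI[of _ "[]"]) auto
next
  case (Suc d)
  then have "\<not> constant (poly p)" by (simp add: constant_degree)
  then obtain z where "poly p z = 0" using fundamental_theorem_of_algebra by blast
  then obtain q where q: "p = [:- z, 1:] * q" by (metis dvdE poly_eq_0_iff_dvd)
  with Suc have q0: "q \<noteq> 0" by auto
  then have "degree p = degree q + 1"
    unfolding q by (subst degree_mult_eq) auto
  with Suc.hyps(2) have "d = degree q" by simp
  from Suc.hyps(1)[OF this q0] obtain c zs where "c \<noteq> 0" "mpoly C q = mat c ** mprod C zs"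
    by blast
  then have "mpoly C p = mat c ** mprod C (z # zs)"
    unfolding q mpoly_linear_factor by (simp add: matrix_mul_assoc mat_comm[of c "C - mat z"])
  with \<open>c \<noteq> 0\<close> show ?case by blast
qed

lemma annihilating_mprod: "\<exists>zs. mprod C zs = 0"
proof -
  obtain p where p: "p \<noteq> 0" "mpoly C p = 0" using annihilating_poly by blast
  obtain c zs where c: "c \<noteq> 0" "mpoly C p = mat c ** mprod C zs" using mpoly_splits p by blast
  have "mprod C zs = mat (inverse c) ** (mat c ** mprod C zs)"
    using c by (simp add: matrix_mul_assoc flip: mat_mult)
  with c p show ?thesis by auto
qed

section \<open>Invertible factors and Sylvester equations\<close>

lemma det_nz_mult_left: "det D \<noteq> 0 \<Longrightarrow> D ** Z = 0 \<Longrightarrow> Z = 0" for D :: "'a::field^'n^'n"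
  by (metis invertible_det_nz invertible_def matrix_mul_assoc matrix_mul_lid times0_right)

lemma det_nz_mult_right: "det D \<noteq> 0 \<Longrightarrow> Z ** D = 0 \<Longrightarrow> Z = 0" for D :: "'a::field^'n^'n"
  by (metis invertible_det_nz invertible_def matrix_mul_assoc matrix_mul_rid times0_left)

lemma det_eq_0_iff_ker: "det E = 0 \<longleftrightarrow> (\<exists>x. x \<noteq> 0 \<and> E *v x = 0)" for E :: "'a::field^'n^'n"
  using matrix_left_invertible_ker[of E] invertible_det_nz[of E] invertible_left_inverse[of E] by metis

text \<open>Bridges two sign conventions: \<open>hurwitz\<close> speaks of
  \<open>mat z - cmat M\<close>, while the factors of \<open>mprod\<close> are
  \<open>C - mat z\<close>.\<close>

lemma det_uminus_nz: "det (- D) \<noteq> 0 \<longleftrightarrow> det D \<noteq> 0" for D :: "'a::field^'n^'n"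
proof -
  have *: "(\<exists>x. x \<noteq> 0 \<and> (- D) *v x = 0) \<longleftrightarrow> (\<exists>x. x \<noteq> 0 \<and> D *v x = 0)"
    by (simp add: matrix_vector_mult_def vec_eq_iff sum_negf)
  show ?thesis
    by (simp only: det_eq_0_iff_ker *)
qed

text \<open>A factor whose root lies in the closed right half-plane is invertible, since that root
  is not an eigenvalue, and can be cancelled from an annihilating product.\<close>

lemma hurwitz_annihilating:
  assumes "hurwitz M"
  shows "\<exists>zs. (\<forall>z\<in>set zs. Re z < 0) \<and> mprod (cmat M) zs = 0"
proof -
  obtain zs where zs: "mprod (cmat M) zs = 0" using annihilating_mprod by blast
  \<comment> \<open>The right factor \<open>D\<close> absorbs each factor that is kept, so that the
    induction can go on with the remaining ones.\<close>
  have "mprod (cmat M) zs ** D = 0 \<Longrightarrow> mprod (cmat M) (filter (\<lambda>z. Re z < 0) zs) ** D = 0" for D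
  proof (induction zs arbitrary: D)
    case (Cons z zs)
    show ?case
    proof (cases "Re z < 0")
      case True
      from Cons.prems have "mprod (cmat M) zs ** ((cmat M - mat z) ** D) = 0"
        by (simp add: mprod_comm matrix_mul_assoc)
      from Cons.IH[OF this] True show ?thesis
        by (simp add: mprod_comm matrix_mul_assoc)
    next
      case False
      then have "det (mat z - cmat M) \<noteq> 0"
        using assms unfolding hurwitz_def by blast
      then have "det (cmat M - mat z) \<noteq> 0"
        using det_uminus_nz[of "mat z - cmat M"] by simp
      then have "mprod (cmat M) zs ** D = 0"
        using Cons.prems det_nz_mult_left by (simp flip: matrix_mul_assoc)
      with Cons.IH False show ?thesis by simp
    qed
  qed simp
  from this[of "mat 1"] zs have "mprod (cmat M) (filter (\<lambda>z. Re z < 0) zs) = 0" by simp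
  moreover have "\<forall>z\<in>set (filter (\<lambda>z. Re z < 0) zs). Re z < 0" by simp
  ultimately show ?thesis by blast
qed

lemma cmat_mult: "cmat (M ** N) = cmat M ** cmat N"
  by (simp add: cmat_def matrix_matrix_mult_def vec_eq_iff)

lemma cmat_add: "cmat (M + N) = cmat M + cmat N"
  by (simp add: cmat_def vec_eq_iff)

lemma cmat_0 [simp]: "cmat M = 0 \<longleftrightarrow> M = 0"
  by (simp add: cmat_def vec_eq_iff)

lemma hurwitz_transpose [simp]: "hurwitz (transpose M) = hurwitz M"
proof -
  have "mat z - cmat (transpose M) = transpose (mat z - cmat M)" for z
    by (auto simp: cmat_def transpose_def mat_def vec_eq_iff)
  then show ?thesis by (simp add: hurwitz_def)
qed

text \<open>Left multiplication by \<open>cmat M - mat z\<close> maps solutions to solutions, so the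
  annihilating factors can be peeled off one at a time. Once (M - z) Z vanishes, M Z = z Z turns the
  equation into Z (-z - N) = 0, and -z has positive real part, hence is no eigenvalue of N.\<close>

lemma sylvester_unique:
  assumes "hurwitz M" "hurwitz N" and eq: "M ** X + X ** N = 0"
  shows "X = 0"
proof -
  obtain zs where zs: "\<forall>z\<in>set zs. Re z < 0" "mprod (cmat M) zs = 0"
    using hurwitz_annihilating assms by blast
  have "Z = 0" if "mprod (cmat M) zs ** Z = 0" "cmat M ** Z + Z ** cmat N = 0" for Z
    using that zs(1)
  proof (induction zs arbitrary: Z)
    case (Cons z zs)
    let ?Z = "(cmat M - mat z) ** Z"
    have "mprod (cmat M) zs ** ?Z = 0"
      using Cons.prems by (simp add: mprod_comm matrix_mul_assoc)
    moreover have "cmat M ** ?Z + ?Z ** cmat N = (cmat M - mat z) ** (cmat M ** Z + Z ** cmat N)"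
      by (simp add: matrix_distribs matrix_mul_assoc mat_comm[of z "cmat M"])
    ultimately have *: "?Z = 0"
      using Cons by simp
    then have "Z ** (mat (- z) - cmat N) = 0"
    proof -
      have "cmat M ** Z = Z ** mat z" using * by (simp add: matrix_distribs mat_comm[of z Z])
      with Cons.prems(2) have "Z ** mat z + Z ** cmat N = 0" by simp
      moreover have "Z ** (mat (- z) - cmat N) = - (Z ** mat z + Z ** cmat N)"
        by (simp add: matrix_distribs mat_minus)
      ultimately show ?thesis by simp
    qed
    moreover have "det (mat (- z) - cmat N) \<noteq> 0"
      using Cons.prems(3) assms(2) unfolding hurwitz_def by fastforce
    ultimately show ?case using det_nz_mult_right by blast
  qed simp
  from this[of "cmat X"] zs eq have "cmat X = 0"
    by (simp flip: cmat_mult cmat_add)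
  then show ?thesis by simp
qed

subsection \<open>Quadratic Lyapunov functions\<close>

definition cvec :: "real^'n \<Rightarrow> complex^'n" where
  "cvec x = (\<chi> i. complex_of_real (x $ i))"

lemma linear_cvec: "linear cvec"
  by (auto intro!: linearI simp: cvec_def vec_eq_iff scaleR_conv_of_real[where 'a=complex])

lemma norm_cvec [simp]: "norm (cvec x) = norm x"
  by (simp add: norm_vec_def cvec_def L2_set_def)

lemma cmat_cvec: "cmat M *v cvec x = cvec (M *v x)"
  by (simp add: cmat_def cvec_def matrix_vector_mult_def vec_eq_iff)

text \<open>The inner product on \<open>complex^'n\<close> is the real part of the Hermitian one, so
  the imaginary part of \<open>z\<close> rotates \<open>w\<close> orthogonally and drops
  out.\<close>

lemma inner_smult_self: "w \<bullet> (z *s w) = Re z * (norm w)\<^sup>2" for w :: "complex^'n"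
proof -
  have "x \<bullet> (z * x) = Re z * (x \<bullet> x)" for x
    by (simp add: inner_complex_def algebra_simps)
  then show ?thesis
    by (simp add: power2_norm_eq_inner inner_vec_def sum_distrib_left)
qed

text \<open>The matrix of w* w. It turns squared norms of complex-valued linear maps into real
  quadratic forms.\<close>

lemma gram_matrix:
  fixes w :: "real^'n \<Rightarrow> 'b::euclidean_space"
  assumes "linear w"
  obtains Q :: "real^'n^'n" where "transpose Q = Q" "\<And>u v. u \<bullet> (Q *v v) = w u \<bullet> w v"
proof
  define Q where "Q = matrix (adjoint w \<circ> w)"
  have "linear (adjoint w \<circ> w)"
    using assms adjoint_linear linear_compose by blast
  then have Q: "Q *v v = adjoint w (w v)" for v
    by (simp add: Q_def matrix_works linear_matrix_vector_mul_eq)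
  then show *: "u \<bullet> (Q *v v) = w u \<bullet> w v" for u v
    by (simp add: adjoint_works[OF assms])
  have "(transpose Q *v u) \<bullet> v = (Q *v u) \<bullet> v" for u v
    using *[of u v] *[of v u] inner_matrix_vector[of u Q v] by (simp add: inner_commute)
  then have "transpose Q *v u = Q *v u" for u
    by (metis inner_commute vector_eq_ldot)
  then show "transpose Q = Q"
    by (simp add: matrix_eq del: transpose_matrix_vector)
qed

text \<open>If \<open>zs\<close> annihilates \<open>M\<close>, the error term vanishes. The matrix \<open>P\<close> represents
  \<open>v \<mapsto> \<Sum>\<^sub>k (2 / a\<^sup>2)\<^sup>k |E\<^sub>k v|\<^sup>2\<close>, where \<open>E\<^sub>k\<close> is the product over the last \<open>k\<close> factors of \<open>zs\<close>:
  since \<open>E\<^sub>k M = z E\<^sub>k + E\<^sub>k\<^sub>+\<^sub>1\<close>, these weights let each term absorb the cross term of its predecessor.\<close>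

lemma lyapunov_suffixes:
  fixes M :: "real^'n^'n"
  assumes a: "0 < a" and "\<forall>z\<in>set zs. Re z \<le> - a"
  shows "\<exists>P. transpose P = P \<and> (\<forall>v. (if zs = [] then 0 else v \<bullet> v) \<le> v \<bullet> (P *v v)) \<and>
    (\<forall>v. 2 * (v \<bullet> (P *v (M *v v))) \<le>
       - (a / 2) * (v \<bullet> (P *v v)) +
       (a / 2) * (2 / a\<^sup>2) ^ length zs * (norm (mprod (cmat M) zs *v cvec v))\<^sup>2)"
  using assms(2)
proof (induction zs)
  case Nil
  then show ?case
    using a by (intro exI[of _ 0]) (auto simp: transpose_zero)
next
  case (Cons z zs)
  from Cons obtain P where P: "transpose P = P"
      "\<And>v. (if zs = [] then 0 else v \<bullet> v) \<le> v \<bullet> (P *v v)"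
      "\<And>v. 2 * (v \<bullet> (P *v (M *v v))) \<le> - (a / 2) * (v \<bullet> (P *v v)) +
         (a / 2) * (2 / a\<^sup>2) ^ length zs * (norm (mprod (cmat M) zs *v cvec v))\<^sup>2"
    by auto
  define w where "w v = mprod (cmat M) zs *v cvec v" for v
  define w' where "w' v = mprod (cmat M) (z # zs) *v cvec v" for v
  define c where "c = (2 / a\<^sup>2) ^ length zs"
  have c: "c > 0" using a by (simp add: c_def)
  have "linear w"
    unfolding w_def using linear_compose[OF linear_cvec matrix_vector_mul_linear] by (simp add: o_def)
  then obtain Q where Q: "transpose Q = Q" "\<And>u v. u \<bullet> (Q *v v) = w u \<bullet> w v"
    using gram_matrix by blast
  have wM: "w (M *v v) = w' v + z *s w v" for v
  proof -
    have "w (M *v v) = (mprod (cmat M) zs ** (cmat M - mat 0)) *v cvec v"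
      by (simp add: w_def matrix_vector_mul_assoc flip: cmat_cvec)
    also have "\<dots> = (cmat M ** mprod (cmat M) zs) *v cvec v"
      by (simp only: mprod_comm[symmetric]) simp
    also have "\<dots> = w' v + z *s w v"
      by (simp add: w_def w'_def matrix_distribs matrix_vector_mult_diff_rdistrib mat_mult_vector
          flip: matrix_vector_mul_assoc)
    finally show ?thesis .
  qed
  \<comment> \<open>Young's inequality bounds the cross term by a |w|^2 + |w'|^2 / a; the root
    contributes at most -2 a |w|^2, which leaves -a |w|^2.\<close>
  have key: "2 * (w v \<bullet> w (M *v v)) \<le> - a * (norm (w v))\<^sup>2 + (norm (w' v))\<^sup>2 / a" for v
  proof -
    have "0 \<le> (norm (a *\<^sub>R w v - w' v))\<^sup>2 / a" using a by simp
    also have "\<dots> = a * (norm (w v))\<^sup>2 + (norm (w' v))\<^sup>2 / a - 2 * (w v \<bullet> w' v)"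
    proof -
      have "(norm (a *\<^sub>R w v - w' v))\<^sup>2 = a * (a * (norm (w v))\<^sup>2) + (norm (w' v))\<^sup>2 - a * (2 * (w v \<bullet> w' v))"
        by (simp add: power2_norm_eq_inner inner_diff_left inner_diff_right inner_commute[of "w' v" "w v"] algebra_simps)
      with a show ?thesis by (simp add: field_simps)
    qed
    finally have "2 * (w v \<bullet> w' v) \<le> a * (norm (w v))\<^sup>2 + (norm (w' v))\<^sup>2 / a" by simp
    moreover have "Re z * (norm (w v))\<^sup>2 \<le> - a * (norm (w v))\<^sup>2"
      using Cons.prems by (intro mult_right_mono) auto
    ultimately show ?thesis by (simp add: wM inner_add_right inner_smult_self)
  qed
  define P' where "P' = P + c *\<^sub>R Q"
  have P'v: "u \<bullet> (P' *v v) = u \<bullet> (P *v v) + c * (w u \<bullet> w v)" for u v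
    by (simp add: P'_def matrix_vector_mult_add_rdistrib inner_add_right Q
        scaleR_matrix_vector_assoc[symmetric])
  have "v \<bullet> v \<le> v \<bullet> (P' *v v)" for v
  \<comment> \<open>The lower bound comes from the term for the empty product, the identity with
    weight 1; it is the first one added.\<close>
  proof (cases "zs = []")
    case True
    then show ?thesis using P(2)[of v] by (simp add: P'v w_def c_def power2_norm_eq_inner[symmetric])
  next
    case False
    then have "v \<bullet> v \<le> v \<bullet> (P *v v)" "0 \<le> c * (w v \<bullet> w v)"
      using P(2)[of v] c by auto
    then show ?thesis by (simp add: P'v)
  qed
  moreover have "2 * (v \<bullet> (P' *v (M *v v))) \<le>
       - (a / 2) * (v \<bullet> (P' *v v)) +
       (a / 2) * (2 / a\<^sup>2) ^ length (z # zs) * (norm (mprod (cmat M) (z # zs) *v cvec v))\<^sup>2" for v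
  proof -
    \<comment> \<open>Of the decay a c |w|^2, one half is kept as the rate and the other pays for
      the error (a/2) c |w|^2 inherited from \<open>P\<close>. The new error (c/a) |w'|^2 is (a/2)
      times c (2/a^2) |w'|^2, which fixes the ratio of the weights.\<close>
    have "c * (2 * (w v \<bullet> w (M *v v))) \<le> c * (- a * (norm (w v))\<^sup>2 + (norm (w' v))\<^sup>2 / a)"
      using c key by (intro mult_left_mono) auto
    moreover have "c * ((norm (w' v))\<^sup>2 / a) = (a / 2) * (2 / a\<^sup>2) ^ length (z # zs) * (norm (w' v))\<^sup>2"
      using a by (simp add: c_def field_simps power2_eq_square)
    moreover have "2 * (v \<bullet> (P *v (M *v v))) \<le> - (a / 2) * (v \<bullet> (P *v v)) + (a / 2) * c * (norm (w v))\<^sup>2"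
      using P(3)[of v] by (simp add: c_def w_def)
    ultimately show ?thesis
      unfolding w'_def[symmetric] P'v power2_norm_eq_inner[of "w v", symmetric]
      by (simp add: algebra_simps)
  qed
  moreover have "transpose P' = P'"
    by (simp add: P'_def transpose_distribs P Q)
  ultimately show ?case by (intro exI[of _ P']) auto
qed

text \<open>Half the derivative of x^T P x along x' = M x is negative. For fixed \<open>P\<close>
  this is an open condition on \<open>M\<close>.\<close>

definition lyapunov_for :: "real^'n^'n \<Rightarrow> real^'n^'n \<Rightarrow> bool" where
  "lyapunov_for M P \<longleftrightarrow> pd P \<and> (\<forall>x. x \<noteq> 0 \<longrightarrow> x \<bullet> (P *v (M *v x)) < 0)"

lemma hurwitz_imp_lyapunov:
  assumes "hurwitz M"
  shows "\<exists>P. lyapunov_for M P"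
proof -
  obtain zs where zs: "\<forall>z\<in>set zs. Re z < 0" "mprod (cmat M) zs = 0"
    using hurwitz_annihilating assms by blast
  \<comment> \<open>An empty list would force \<open>mat 1\<close> to be zero. Nonemptiness gives
    access to the lower bound in \<open>lyapunov_suffixes\<close> and makes \<open>Min\<close>
    meaningful.\<close>
  have "zs \<noteq> []"
  proof
    assume "zs = []"
    then have "(mat 1 :: complex^'a^'a) = 0" using zs by simp
    then have "(mat 1 :: complex^'a^'a) $ undefined $ undefined = 0" by simp
    then show False by (simp add: mat_def)
  qed
  define a where "a = Min ((\<lambda>z. - Re z) ` set zs)"
  have a: "0 < a" "\<forall>z\<in>set zs. Re z \<le> - a"
  proof -
    show "0 < a" using zs(1) \<open>zs \<noteq> []\<close> by (auto simp: a_def)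
    have "a \<le> - Re z" if "z \<in> set zs" for z
      unfolding a_def using that by (intro Min_le) auto
    then show "\<forall>z\<in>set zs. Re z \<le> - a" by force
  qed
  from lyapunov_suffixes[OF this, of M] zs(2) \<open>zs \<noteq> []\<close> obtain P where P: "transpose P = P"
      "\<And>v. v \<bullet> v \<le> v \<bullet> (P *v v)" "\<And>v. 2 * (v \<bullet> (P *v (M *v v))) \<le> - (a / 2) * (v \<bullet> (P *v v))"
    by auto
  have pos: "0 < x \<bullet> (P *v x)" if "x \<noteq> 0" for x
    using P(2)[of x] that by (smt (verit) inner_gt_zero_iff)
  have "x \<bullet> (P *v (M *v x)) < 0" if "x \<noteq> 0" for x
    using P(3)[of x] mult_pos_pos[OF a(1) pos[OF that]] by simp
  with P pos show ?thesis by (auto simp: lyapunov_for_def pd_def)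
qed

text \<open>Real and imaginary parts of (a + i b) as an eigenvector for \<alpha> + i \<beta>, so
  that real quadratic forms can be evaluated on eigenvectors.\<close>

lemma hurwitz_iff_real:
  "hurwitz M \<longleftrightarrow> (\<forall>\<alpha> \<beta> a b. M *v a = \<alpha> *\<^sub>R a - \<beta> *\<^sub>R b \<longrightarrow> M *v b = \<alpha> *\<^sub>R b + \<beta> *\<^sub>R a \<longrightarrow>
     0 \<le> \<alpha> \<longrightarrow> a = 0 \<and> b = 0)"
proof -
  have "det (mat z - cmat M) = 0 \<longleftrightarrow> (\<exists>a b. \<not> (a = 0 \<and> b = 0) \<and>
      M *v a = Re z *\<^sub>R a - Im z *\<^sub>R b \<and> M *v b = Re z *\<^sub>R b + Im z *\<^sub>R a)" (is "_ \<longleftrightarrow> (\<exists>a b. ?P a b)") for z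
  proof -
    have ker: "det (mat z - cmat M) = 0 \<longleftrightarrow> (\<exists>v. v \<noteq> 0 \<and> cmat M *v v = z *s v)"
      by (auto simp: det_eq_0_iff_ker matrix_vector_mult_diff_rdistrib mat_mult_vector)
    have split: "?P (\<chi> i. Re (v $ i)) (\<chi> i. Im (v $ i)) \<longleftrightarrow> v \<noteq> 0 \<and> cmat M *v v = z *s v" for v
      by (auto simp: vec_eq_iff complex_eq_iff cmat_def matrix_vector_mult_def)
    show ?thesis
      unfolding ker
    proof
      assume "\<exists>v. v \<noteq> 0 \<and> cmat M *v v = z *s v"
      with split show "\<exists>a b. ?P a b" by blast
    next
      assume "\<exists>a b. ?P a b"
      then obtain a b where ab: "?P a b" by blast
      define v where "v = (\<chi> i. Complex (a $ i) (b $ i))"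
      have "(\<chi> i. Re (v $ i)) = a" "(\<chi> i. Im (v $ i)) = b"
        by (simp_all add: v_def vec_eq_iff)
      with ab split[of v] show "\<exists>v. v \<noteq> 0 \<and> cmat M *v v = z *s v" by auto
    qed
  qed
  then have *: "hurwitz M \<longleftrightarrow> (\<forall>z. (\<exists>a b. \<not> (a = 0 \<and> b = 0) \<and>
      M *v a = Re z *\<^sub>R a - Im z *\<^sub>R b \<and> M *v b = Re z *\<^sub>R b + Im z *\<^sub>R a) \<longrightarrow> Re z < 0)"
    unfolding hurwitz_def by simp
  show ?thesis
  proof
    assume "hurwitz M"
    then show "\<forall>\<alpha> \<beta> a b. M *v a = \<alpha> *\<^sub>R a - \<beta> *\<^sub>R b \<longrightarrow> M *v b = \<alpha> *\<^sub>R b + \<beta> *\<^sub>R a \<longrightarrow>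
     0 \<le> \<alpha> \<longrightarrow> a = 0 \<and> b = 0"
      unfolding * by (metis complex.sel not_less)
  next
    assume h: "\<forall>\<alpha> \<beta> a b. M *v a = \<alpha> *\<^sub>R a - \<beta> *\<^sub>R b \<longrightarrow> M *v b = \<alpha> *\<^sub>R b + \<beta> *\<^sub>R a \<longrightarrow>
     0 \<le> \<alpha> \<longrightarrow> a = 0 \<and> b = 0"
    show "hurwitz M"
      unfolding *
    proof (intro allI impI)
      fix z
      assume "\<exists>a b. \<not> (a = 0 \<and> b = 0) \<and>
        M *v a = Re z *\<^sub>R a - Im z *\<^sub>R b \<and> M *v b = Re z *\<^sub>R b + Im z *\<^sub>R a"
      then obtain a b where "\<not> (a = 0 \<and> b = 0)"
        "M *v a = Re z *\<^sub>R a - Im z *\<^sub>R b" "M *v b = Re z *\<^sub>R b + Im z *\<^sub>R a" by blast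
      with h[rule_format, of a "Re z" "Im z" b] show "Re z < 0" by linarith
    qed
  qed
qed

text \<open>The real part of v* P M v = z v* P v for v = a + i b; the \<beta>-terms cancel because
  \<open>P\<close> is symmetric.\<close>

lemma eigenpair_energy:
  fixes P :: "real^'n^'n"
  assumes "transpose P = P" "M *v a = \<alpha> *\<^sub>R a - \<beta> *\<^sub>R b" "M *v b = \<alpha> *\<^sub>R b + \<beta> *\<^sub>R a"
  shows "a \<bullet> (P *v (M *v a)) + b \<bullet> (P *v (M *v b)) = \<alpha> * (a \<bullet> (P *v a) + b \<bullet> (P *v b))"
proof -
  have "a \<bullet> (P *v b) = b \<bullet> (P *v a)"
    using inner_matrix_vector[of a P b] assms(1) by (simp add: inner_commute)
  then show ?thesis
    unfolding assms(2,3) by (simp add: matrix_vector_right_distrib matrix_vector_mult_diff_distrib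
        matrix_vector_mult_scaleR inner_add_right inner_diff_right algebra_simps)
qed

lemma lyapunov_imp_hurwitz:
  assumes "lyapunov_for M P"
  shows "hurwitz M"
  unfolding hurwitz_iff_real
proof (intro allI impI)
  fix \<alpha> \<beta> :: real and a b
  assume eig: "M *v a = \<alpha> *\<^sub>R a - \<beta> *\<^sub>R b" "M *v b = \<alpha> *\<^sub>R b + \<beta> *\<^sub>R a" and "0 \<le> \<alpha>"
  have P: "pd P" and neg: "\<And>x. x \<noteq> 0 \<Longrightarrow> x \<bullet> (P *v (M *v x)) < 0"
    using assms by (auto simp: lyapunov_for_def)
  have le: "x \<bullet> (P *v (M *v x)) \<le> 0" "0 \<le> x \<bullet> (P *v x)" for x
    using neg[of x] P by (cases "x = 0"; force simp: pd_def)+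
  have "a \<bullet> (P *v (M *v a)) + b \<bullet> (P *v (M *v b)) = \<alpha> * (a \<bullet> (P *v a) + b \<bullet> (P *v b))"
    using eigenpair_energy[OF _ eig] P by (simp add: pd_def)
  also have "\<dots> \<ge> 0" using \<open>0 \<le> \<alpha>\<close> le by (simp add: add_nonneg_nonneg)
  finally show "a = 0 \<and> b = 0"
    using neg[of a] neg[of b] le(1)[of a] le(1)[of b] by force
qed

section \<open>Extremal arguments for quadratic forms\<close>

lemma sphere_attains:
  fixes g :: "real^'n \<Rightarrow> real"
  assumes "continuous_on (sphere 0 1) g"
  obtains v where "norm v = 1" "\<And>u. norm u = 1 \<Longrightarrow> g v \<le> g u"
proof -
  have "sphere (0::real^'n) 1 \<noteq> {}"
    using vector_choose_size[of 1] by (metis dist_0_norm empty_iff mem_sphere zero_le_one)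
  with assms that show ?thesis
    using continuous_attains_inf[of "sphere 0 1" g] by auto
qed

lemma quadratic_bound:
  fixes N :: "real^'n^'n"
  assumes "\<And>x. x \<noteq> 0 \<Longrightarrow> 0 < x \<bullet> (N *v x)"
  obtains c where "c > 0" "\<And>x. c * (norm x)\<^sup>2 \<le> x \<bullet> (N *v x)"
proof -
  obtain v where v: "norm v = 1" "\<And>u. norm u = 1 \<Longrightarrow> v \<bullet> (N *v v) \<le> u \<bullet> (N *v u)"
    by (rule sphere_attains[of "\<lambda>u. u \<bullet> (N *v u)"]) (auto intro!: continuous_intros)
  show ?thesis
  proof
    show "0 < v \<bullet> (N *v v)" using v assms[of v] by force
    show "v \<bullet> (N *v v) * (norm x)\<^sup>2 \<le> x \<bullet> (N *v x)" for x
    proof (cases "x = 0")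
      case False
      define u where "u = inverse (norm x) *\<^sub>R x"
      have "norm u = 1" "x = norm x *\<^sub>R u" using False by (auto simp: u_def)
      then have "x \<bullet> (N *v x) = (norm x)\<^sup>2 * (u \<bullet> (N *v u))"
        by (metis (no_types) inner_scaleR_left inner_scaleR_right matrix_vector_mult_scaleR mult.assoc power2_eq_square)
      with v(2)[OF \<open>norm u = 1\<close>] show ?thesis by (simp add: mult.commute[of "(norm x)\<^sup>2"] mult_right_mono)
    qed simp
  qed
qed

text \<open>A zero of a nonnegative form is a minimum, so the gradient 2 S x vanishes there; the
  proof tests this along -S x.\<close>

lemma psd_kernel:
  fixes S :: "real^'n^'n"
  assumes "psd S" "x \<bullet> (S *v x) = 0"
  shows "S *v x = 0"
proof (rule ccontr)
  define y where "y = S *v x"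
  assume "S *v x \<noteq> 0"
  then have y: "0 < y \<bullet> y" by (simp add: y_def)
  define k where "k = y \<bullet> (S *v y)"
  have sym: "x \<bullet> (S *v y) = y \<bullet> y"
    using assms(1) inner_matrix_vector[of x S y] by (simp add: psd_def y_def)
  have quad: "0 \<le> t\<^sup>2 * k - 2 * t * (y \<bullet> y)" for t
  proof -
    have "0 \<le> (x - t *\<^sub>R y) \<bullet> (S *v (x - t *\<^sub>R y))" using assms(1) by (simp add: psd_def)
    also have "\<dots> = t\<^sup>2 * k - 2 * t * (y \<bullet> y)"
      using assms(2) sym by (simp add: matrix_vector_mult_diff_distrib matrix_vector_mult_scaleR
          inner_diff_left inner_diff_right k_def power2_eq_square algebra_simps flip: y_def)
    finally show ?thesis .
  qed
  have k: "0 \<le> k" using assms(1) by (simp add: psd_def k_def)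
  \<comment> \<open>Near the minimiser of t^2 k - 2 t (y . y); the added 1 covers k = 0. The
    quadratic takes the negative value -s^2 (k + 2) at t = s.\<close>
  define s where "s = y \<bullet> y / (k + 1)"
  have s: "0 < s" "y \<bullet> y = s * (k + 1)" using y k by (auto simp: s_def)
  have "0 \<le> s\<^sup>2 * (- k - 2)"
    using quad[of s] by (simp add: s(2) power2_eq_square algebra_simps)
  moreover have "s\<^sup>2 * (- k - 2) < 0"
    using s k by (intro mult_pos_neg) auto
  ultimately show False by simp
qed

text \<open>Instead of following the flow of M, take the minimiser v of the Rayleigh quotient of X
  relative to a Lyapunov matrix P. If the minimum t is negative, v lies in the kernel of the
  semidefinite X - t P, so v . X M v = t (v . P M v) > 0, against the assumption.\<close>

lemma lyapunov_psd:
  fixes M X :: "real^'n^'n"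
  assumes "hurwitz M" "transpose X = X" and neg: "\<And>x. x \<bullet> (X *v (M *v x)) \<le> 0"
  shows "psd X"
proof (rule ccontr)
  assume "\<not> psd X"
  with assms(2) obtain y where y: "y \<bullet> (X *v y) < 0" by (auto simp: psd_def not_le)
  obtain P where P: "transpose P = P" and Ppos: "\<And>x. x \<noteq> 0 \<Longrightarrow> 0 < x \<bullet> (P *v x)"
    and PM: "\<And>x. x \<noteq> 0 \<Longrightarrow> x \<bullet> (P *v (M *v x)) < 0"
    using hurwitz_imp_lyapunov[OF assms(1)] by (auto simp: lyapunov_for_def pd_def)
  define g where "g x = (x \<bullet> (X *v x)) / (x \<bullet> (P *v x))" for x
  have "continuous_on (sphere 0 1) g"
    unfolding g_def using Ppos by (intro continuous_intros) (metis dist_0_norm less_irrefl mem_sphere norm_zero zero_neq_one)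
  then obtain v where v: "norm v = 1" "\<And>u. norm u = 1 \<Longrightarrow> g v \<le> g u"
    using sphere_attains by blast
  have gle: "g v \<le> g x" if "x \<noteq> 0" for x
  proof -
    define u where "u = inverse (norm x) *\<^sub>R x"
    have "norm u = 1" using that by (simp add: u_def)
    moreover have "g u = g x"
      using that by (simp add: g_def u_def matrix_vector_mult_scaleR)
    ultimately show ?thesis using v(2) by metis
  qed
  have "y \<noteq> 0" using y by auto
  then have "g y < 0" using y Ppos by (simp add: g_def divide_neg_pos)
  with gle \<open>y \<noteq> 0\<close> have t: "g v < 0" by force
  define S where "S = X - g v *\<^sub>R P"
  have Sv: "x \<bullet> (S *v z) = x \<bullet> (X *v z) - g v * (x \<bullet> (P *v z))" for x z
    by (simp add: S_def matrix_vector_mult_diff_rdistrib inner_diff_right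
        scaleR_matrix_vector_assoc[symmetric])
  have "0 \<le> x \<bullet> (S *v x)" for x
  proof (cases "x = 0")
    case False
    with gle[OF False] Ppos[OF False] show ?thesis by (simp add: Sv g_def le_divide_eq)
  qed simp
  moreover have symS: "transpose S = S" by (simp add: S_def transpose_distribs P assms(2))
  ultimately have "psd S" by (simp add: psd_def)
  have v0: "v \<noteq> 0" using v by auto
  have "v \<bullet> (S *v v) = 0" using Ppos[OF v0] by (simp add: Sv g_def)
  then have "S *v v = 0" using psd_kernel \<open>psd S\<close> by blast
  then have "v \<bullet> (S *v (M *v v)) = 0"
    using inner_matrix_vector[of v S "M *v v"] symS by simp
  moreover have "0 < g v * (v \<bullet> (P *v (M *v v)))"
    using t PM[OF v0] by (simp add: mult_neg_neg)
  ultimately show False using neg[of v] by (simp add: Sv)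
qed

subsection \<open>Lyapunov equations and the LQR problem\<close>

lemma bounded_bilinear_matrix_vector_mult:
  "bounded_bilinear ((*v) :: real^'n^'m \<Rightarrow> real^'n \<Rightarrow> real^'m)"
  by (auto simp: bilinear_conv_bounded_bilinear[symmetric] bilinear_def
      matrix_vector_mult_add_rdistrib scaleR_matrix_vector_assoc intro!: linearI)

text \<open>One \<open>P\<close> and one decay constant serve a whole neighbourhood of
  \<open>M\<close>, both for openness and for uniform resolvent bounds.\<close>

lemma lyapunov_for_nhd:
  fixes M P :: "real^'n^'n"
  assumes "lyapunov_for M P"
  obtains c e where "c > 0" "e > 0"
    "\<And>N x. dist N M < e \<Longrightarrow> x \<bullet> (P *v (N *v x)) \<le> - c * (norm x)\<^sup>2"
proof -
  have "0 < x \<bullet> ((- (P ** M)) *v x)" if "x \<noteq> 0" for x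
  proof -
    have "(- (P ** M)) *v x = - (P *v (M *v x))"
      using matrix_vector_mult_diff_rdistrib[of 0 "P ** M" x] by (simp add: matrix_vector_mul_assoc)
    with assms that show ?thesis by (simp add: lyapunov_for_def)
  qed
  then obtain c where c: "c > 0" "\<And>x. c * (norm x)\<^sup>2 \<le> x \<bullet> ((- (P ** M)) *v x)"
    using quadratic_bound by metis
  have cM: "x \<bullet> (P *v (M *v x)) \<le> - c * (norm x)\<^sup>2" for x
    using c(2)[of x] matrix_vector_mult_diff_rdistrib[of 0 "P ** M" x]
    by (simp add: matrix_vector_mul_assoc)
  obtain k where k: "k > 0" "\<And>(A::real^'n^'n) x. norm (A *v x) \<le> norm A * norm x * k"
    using bounded_bilinear.pos_bounded[OF bounded_bilinear_matrix_vector_mult] by blast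
  \<comment> \<open>Chosen so that the perturbation uses up at most half of the margin c |x|^2;
    \<open>norm P + 1\<close> keeps the denominator positive.\<close>
  define e where "e = c / (2 * k * k * (norm P + 1))"
  have d: "0 < 2 * k * k * (norm P + 1)" using k(1) by (intro mult_pos_pos) (auto simp: add_nonneg_pos)
  have e: "e > 0" using c(1) d by (simp add: e_def)
  show thesis
  proof (rule that[of "c / 2" e])
    fix N :: "real^'n^'n" and x
    assume N: "dist N M < e"
    have "x \<bullet> (P *v ((N - M) *v x)) \<le> norm x * norm (P *v ((N - M) *v x))"
      using norm_cauchy_schwarz by blast
    also have "\<dots> \<le> norm x * (norm P * (norm (N - M) * norm x * k) * k)"
      using k by (intro mult_left_mono order_trans[OF k(2)] mult_right_mono) auto
    also have "\<dots> = (norm x)\<^sup>2 * (norm P * k * k * norm (N - M))"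
      by (simp add: power2_eq_square)
    also have "\<dots> \<le> (norm x)\<^sup>2 * ((norm P + 1) * k * k * e)"
      using N k(1) e by (intro mult_left_mono mult_mono) (auto simp: dist_norm)
    also have "(norm P + 1) * k * k * e = c / 2"
      using d by (simp add: e_def field_simps)
    finally have "x \<bullet> (P *v ((N - M) *v x)) \<le> c / 2 * (norm x)\<^sup>2" by (simp add: mult.commute)
    moreover have "x \<bullet> (P *v (N *v x)) = x \<bullet> (P *v (M *v x)) + x \<bullet> (P *v ((N - M) *v x))"
      by (simp add: matrix_vector_mult_diff_rdistrib matrix_vector_mult_diff_distrib inner_diff_right)
    ultimately show "x \<bullet> (P *v (N *v x)) \<le> - (c / 2) * (norm x)\<^sup>2"
      using cM[of x] by simp
  qed (use c e in auto)
qed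

lemma open_hurwitz: "open {M :: real^'n^'n. hurwitz M}"
  unfolding open_dist
proof
  fix M :: "real^'n^'n"
  assume "M \<in> {M. hurwitz M}"
  then obtain P where P: "lyapunov_for M P" using hurwitz_imp_lyapunov by auto
  obtain c e where ce: "c > 0" "e > 0"
      "\<And>N x. dist N M < e \<Longrightarrow> x \<bullet> (P *v (N *v x)) \<le> - c * (norm x)\<^sup>2"
    using lyapunov_for_nhd[OF P] by blast
  have "hurwitz N" if "dist N M < e" for N
  proof (rule lyapunov_imp_hurwitz)
    have "x \<bullet> (P *v (N *v x)) < 0" if "x \<noteq> 0" for x
    proof -
      have "0 < c * (norm x)\<^sup>2" using ce(1) that by simp
      with ce(3)[OF \<open>dist N M < e\<close>, of x] show ?thesis by simp
    qed
    with P show "lyapunov_for N P" by (simp add: lyapunov_for_def)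
  qed
  with ce(2) show "\<exists>e>0. \<forall>N. dist N M < e \<longrightarrow> N \<in> {M. hurwitz M}" by auto
qed

text \<open>In finite dimension the uniqueness for Sylvester equations already gives surjectivity;
  the solution is symmetric because its transpose solves the same equation.\<close>

lemma lyapunov_equation_solvable:
  fixes M W :: "real^'n^'n"
  assumes "hurwitz M" "transpose W = W"
  obtains X where "transpose X = X" "transpose M ** X + X ** M = - W"
proof -
  define f where "f X = transpose M ** X + X ** M" for X
  have lin: "linear f"
    by (auto intro!: linearI simp: f_def matrix_distribs matrix_scalar_ac scalar_matrix_assoc[symmetric] scaleR_add_right)
  moreover have inj: "inj f"
    unfolding linear_injective_0[OF lin]
  proof (intro allI impI)
    fix X assume "f X = 0"
    then show "X = 0"
      unfolding f_def using assms(1) sylvester_unique[of "transpose M" M X] by simp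
  qed
  ultimately have "surj f" by (rule linear_injective_imp_surjective) simp
  then obtain X where X: "f X = - W" by (metis surjD)
  have "f (transpose X) = transpose (f X)"
    by (simp add: f_def transpose_distribs add.commute)
  with X assms(2) have "f (transpose X) = f X"
    by (simp add: transpose_distribs)
  with inj have "transpose X = X" by (simp add: inj_eq)
  with X that show thesis by (simp add: f_def)
qed

lemma lyapunov_equation_form:
  fixes M :: "real^'n^'n"
  assumes "transpose X = X" "transpose M ** X + X ** M = - W"
  shows "x \<bullet> (X *v (M *v x)) = - (x \<bullet> (W *v x)) / 2"
proof -
  have "x \<bullet> ((transpose M ** X) *v x) = x \<bullet> (X *v (M *v x))"
    using inner_matrix_vector[of x "transpose M" "X *v x"] inner_matrix_vector[of "M *v x" X x] assms(1)
    by (simp add: inner_commute flip: matrix_vector_mul_assoc)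
  moreover have "x \<bullet> ((transpose M ** X + X ** M) *v x) = x \<bullet> ((- W) *v x)"
    using assms(2) by simp
  moreover have "(- W) *v x = - (W *v x)"
    using matrix_vector_mult_diff_rdistrib[of 0 W x] by simp
  ultimately show ?thesis
    by (simp add: matrix_vector_mult_add_rdistrib inner_add_right matrix_vector_mul_assoc)
qed

lemma lyapunov_equation_psd:
  assumes "hurwitz M" "transpose X = X" "transpose M ** X + X ** M = - W"
    "\<And>x. 0 \<le> x \<bullet> (W *v x)"
  shows "psd X"
  using assms by (intro lyapunov_psd[OF assms(1,2)]) (simp add: lyapunov_equation_form)

section \<open>Semidefinite matrices and detectability\<close>

lemma pd_imp_psd: "pd R \<Longrightarrow> psd R"
  unfolding pd_def psd_def by (metis inner_zero_left less_eq_real_def)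

lemma psd_add: "psd S \<Longrightarrow> psd T \<Longrightarrow> psd (S + T)"
  by (simp add: psd_def transpose_distribs matrix_vector_mult_add_rdistrib inner_add_right)

lemma congruence_form: "x \<bullet> ((transpose K ** R ** K) *v x) = (K *v x) \<bullet> (R *v (K *v x))" for K :: "real^'n^'m"
  using inner_matrix_vector[of x "transpose K" "R *v (K *v x)"]
  by (simp flip: matrix_vector_mul_assoc)

lemma psd_congruence: "psd R \<Longrightarrow> psd (transpose K ** R ** K)" for K :: "real^'n^'m"
  by (simp add: psd_def congruence_form) (simp add: transpose_distribs matrix_mul_assoc)

lemma pd_invertible: "pd R \<Longrightarrow> \<exists>R'. R ** R' = mat 1 \<and> R' ** R = mat 1"
proof -
  assume "pd R"
  then have "\<forall>x. R *v x = 0 \<longrightarrow> x = 0" by (metis inner_zero_right less_irrefl pd_def)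
  then have "invertible R" using det_eq_0_iff_ker[of R] invertible_det_nz by blast
  then show ?thesis by (auto simp: invertible_def)
qed

text \<open>The Hautus test for detectability, with eigenvectors split into real and imaginary
  parts: none for an eigenvalue in the closed right half-plane is killed by
  \<open>Q\<close>.\<close>

definition undetected_stable :: "real^'n^'n \<Rightarrow> real^'n^'n \<Rightarrow> bool" where
  "undetected_stable Q A \<longleftrightarrow> (\<forall>\<alpha> \<beta> a b. A *v a = \<alpha> *\<^sub>R a - \<beta> *\<^sub>R b \<longrightarrow> A *v b = \<alpha> *\<^sub>R b + \<beta> *\<^sub>R a \<longrightarrow>
     Q *v a = 0 \<longrightarrow> Q *v b = 0 \<longrightarrow> 0 \<le> \<alpha> \<longrightarrow> a = 0 \<and> b = 0)"

text \<open>On an eigenpair with \<alpha> at least 0 the energy is nonnegative, yet it equals minus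
  half of the cost, so the cost vanishes. Then \<open>Q\<close> and \<open>K\<close> annihilate the
  pair, which makes it an undetected eigenpair of \<open>A\<close>. The slack \<open>V\<close> is
  the surplus of a policy step and is 0 in the limit.\<close>

lemma detectable_lyapunov_hurwitz:
  fixes A :: "real^'n^'n" and B :: "real^'m^'n"
  assumes "psd Q" "pd R" "undetected_stable Q A" "psd P" "psd V"
    and eq: "transpose (A + B ** K) ** P + P ** (A + B ** K) = - (Q + transpose K ** R ** K + V)"
  shows "hurwitz (A + B ** K)"
  unfolding hurwitz_iff_real
proof (intro allI impI)
  let ?M = "A + B ** K"
  fix \<alpha> \<beta> :: real and a b
  assume eig: "?M *v a = \<alpha> *\<^sub>R a - \<beta> *\<^sub>R b" "?M *v b = \<alpha> *\<^sub>R b + \<beta> *\<^sub>R a" and "0 \<le> \<alpha>"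
  have symP: "transpose P = P" using assms by (simp add: psd_def)
  define q where "q x = x \<bullet> (Q *v x) + (K *v x) \<bullet> (R *v (K *v x)) + x \<bullet> (V *v x)" for x
  have "x \<bullet> (P *v (?M *v x)) = - q x / 2" for x
    using lyapunov_equation_form[OF symP eq, of x]
    by (simp add: q_def matrix_vector_mult_add_rdistrib[of _ _ x] inner_add_right congruence_form)
  moreover have "a \<bullet> (P *v (?M *v a)) + b \<bullet> (P *v (?M *v b)) = \<alpha> * (a \<bullet> (P *v a) + b \<bullet> (P *v b))"
    using eigenpair_energy[OF symP eig] .
  moreover have "0 \<le> \<alpha> * (a \<bullet> (P *v a) + b \<bullet> (P *v b))"
    using assms(4) \<open>0 \<le> \<alpha>\<close> by (simp add: psd_def)
  ultimately have q: "q a + q b \<le> 0" by simp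
  have nn: "0 \<le> x \<bullet> (Q *v x)" "0 \<le> (K *v x) \<bullet> (R *v (K *v x))" "0 \<le> x \<bullet> (V *v x)" for x
    using assms pd_imp_psd[OF assms(2)] by (auto simp: psd_def)
  have "x \<bullet> (Q *v x) = 0 \<and> (K *v x) \<bullet> (R *v (K *v x)) = 0" if "x \<in> {a, b}" for x
    using that q nn[of a] nn[of b] unfolding q_def by auto
  then have "Q *v x = 0 \<and> K *v x = 0" if "x \<in> {a, b}" for x
    using that psd_kernel[OF assms(1), of x] assms(2) unfolding pd_def by force
  moreover from this have "?M *v x = A *v x" if "x \<in> {a, b}" for x
    using that by (simp add: matrix_vector_mult_add_rdistrib flip: matrix_vector_mul_assoc)
  ultimately show "a = 0 \<and> b = 0"
    using assms(3) eig \<open>0 \<le> \<alpha>\<close> unfolding undetected_stable_def by (metis insertCI)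
qed

section \<open>Monotone limits and policy iteration\<close>

lemma matrix_entry_inner: "M $ i $ j = axis i 1 \<bullet> (M *v axis j 1)" for M :: "real^'n^'m"
  by (simp add: inner_axis' matrix_vector_mul_component inner_axis)

lemma tendsto_matrix_vector_mult:
  "(F \<longlongrightarrow> (M::real^'n^'m)) G \<Longrightarrow> ((\<lambda>n. F n *v x) \<longlongrightarrow> M *v x) G"
  by (rule bounded_bilinear.tendsto[OF bounded_bilinear_matrix_vector_mult _ tendsto_const])

lemma psd_limit:
  fixes P :: "nat \<Rightarrow> real^'n^'n"
  assumes lim: "P \<longlonglongrightarrow> L" and psd: "\<And>n. psd (P n)"
  shows "psd L"
  unfolding psd_def
proof (intro conjI allI)
  have "(\<lambda>n. transpose (P n)) \<longlonglongrightarrow> transpose L"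
    by (rule bounded_linear.tendsto[OF bounded_linear_transpose lim])
  moreover have "(\<lambda>n. transpose (P n)) = P" using psd by (auto simp: psd_def)
  ultimately show "transpose L = L" using lim LIMSEQ_unique by metis
  fix x
  have "(\<lambda>n. x \<bullet> (P n *v x)) \<longlonglongrightarrow> x \<bullet> (L *v x)"
    by (intro tendsto_intros tendsto_matrix_vector_mult lim)
  then show "0 \<le> x \<bullet> (L *v x)"
    using psd by (intro LIMSEQ_le_const) (auto simp: psd_def)
qed

text \<open>Each quadratic form is a decreasing sequence bounded below; polarization carries
  convergence over to the matrix entries.\<close>

lemma decreasing_psd_convergent:
  fixes P :: "nat \<Rightarrow> real^'n^'n"
  assumes psd: "\<And>n. psd (P n)" and dec: "\<And>n. psd (P n - P (Suc n))"
  shows "convergent P"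
proof -
  have q: "convergent (\<lambda>n. x \<bullet> (P n *v x))" for x
  proof (rule Bseq_monoseq_convergent)
    have d: "decseq (\<lambda>n. x \<bullet> (P n *v x))"
      using dec by (intro decseq_SucI) (simp add: psd_def matrix_vector_mult_diff_rdistrib inner_diff_right)
    then show "monoseq (\<lambda>n. x \<bullet> (P n *v x))" by (rule decseq_imp_monoseq)
    have "norm (x \<bullet> (P n *v x)) \<le> x \<bullet> (P 0 *v x)" for n
      using psd[of n] decseqD[OF d, of 0 n] by (simp add: psd_def)
    then show "Bseq (\<lambda>n. x \<bullet> (P n *v x))" by (rule BseqI')
  qed
  have pol: "u \<bullet> (P n *v v) = ((u + v) \<bullet> (P n *v (u + v)) - (u - v) \<bullet> (P n *v (u - v))) / 4" for u v n
  proof -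
    have "v \<bullet> (P n *v u) = u \<bullet> (P n *v v)"
      using inner_matrix_vector[of u "P n" v] psd[of n]
      by (simp add: psd_def inner_commute del: transpose_matrix_vector)
    then show ?thesis
      by (simp add: matrix_vector_right_distrib matrix_vector_mult_diff_distrib inner_add_left
          inner_add_right inner_diff_left inner_diff_right)
  qed
  have "convergent (\<lambda>n. u \<bullet> (P n *v v))" for u v
  proof -
    have "convergent (\<lambda>n. ((u + v) \<bullet> (P n *v (u + v)) - (u - v) \<bullet> (P n *v (u - v))) / 4)"
    proof -
      obtain a b where "(\<lambda>n. (u + v) \<bullet> (P n *v (u + v))) \<longlonglongrightarrow> a" "(\<lambda>n. (u - v) \<bullet> (P n *v (u - v))) \<longlonglongrightarrow> b"
        using q unfolding convergent_def by blast
      then show ?thesis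
        unfolding convergent_def by (intro exI[of _ "(a - b) / 4"] tendsto_divide tendsto_diff tendsto_const) simp_all
    qed
    then show ?thesis by (simp only: pol[symmetric])
  qed
  then have "convergent (\<lambda>n. P n $ i $ j)" for i j
    unfolding matrix_entry_inner by blast
  then have "(\<lambda>n. P n $ i $ j) \<longlonglongrightarrow> lim (\<lambda>n. P n $ i $ j)" for i j
    by (simp add: convergent_LIMSEQ_iff)
  then have "P \<longlonglongrightarrow> (\<chi> i j. lim (\<lambda>n. P n $ i $ j))"
    by (intro vec_tendstoI) simp
  then show ?thesis by (auto simp: convergent_def)
qed

text \<open>One step of Kleinman's policy iteration.\<close>

lemma lqr_policy_step:
  fixes A :: "real^'n^'n" and B :: "real^'m^'n"
  assumes "psd Q" "pd R" "undetected_stable Q A"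
    and P: "psd P" "transpose (A + B ** K) ** P + P ** (A + B ** K) = - (Q + transpose K ** R ** K)"
    and K': "R ** K' = - (transpose B ** P)"
  obtains P' where "hurwitz (A + B ** K')" "psd P'" "psd (P - P')"
    "transpose (A + B ** K') ** P' + P' ** (A + B ** K') = - (Q + transpose K' ** R ** K')"
proof -
  let ?M = "A + B ** K" and ?M' = "A + B ** K'"
  have sym: "transpose Q = Q" "transpose R = R" "transpose P = P"
    using assms by (auto simp: psd_def pd_def)
  have K'T: "transpose K' ** R = - (P ** B)"
    using arg_cong[OF K', of transpose] by (simp add: transpose_distribs sym)
  \<comment> \<open>The surplus from completing the square when \<open>K\<close> is replaced by
    \<open>K'\<close> in the equation of \<open>P\<close>. It leaves \<open>K'\<close> stabilizing,
    and as the right-hand side of the equation for \<open>P - P'\<close> it makes the costs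
    decrease.\<close>
  define V where "V = transpose (K - K') ** R ** (K - K')"
  have V: "psd V" unfolding V_def using assms pd_imp_psd psd_congruence by blast
  have M': "?M' = ?M + B ** (K' - K)" by (simp add: matrix_distribs)
  have cross: "transpose (K' - K) ** (transpose B ** P) = - (transpose (K' - K) ** (R ** K'))"
    "(P ** B) ** (K' - K) = - ((transpose K' ** R) ** (K' - K))"
    by (simp_all add: K' K'T matrix_distribs)
  have "transpose ?M' ** P + P ** ?M' =
      (transpose ?M ** P + P ** ?M) + (transpose (K' - K) ** (transpose B ** P) + (P ** B) ** (K' - K))"
    unfolding M' by (simp add: transpose_distribs matrix_distribs matrix_mul_assoc)
  also have "\<dots> = - (Q + transpose K' ** R ** K' + V)"
    unfolding P(2) cross V_def by (simp add: transpose_distribs matrix_distribs matrix_mul_assoc)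
  finally have eq: "transpose ?M' ** P + P ** ?M' = - (Q + transpose K' ** R ** K' + V)" .
  have hur: "hurwitz ?M'"
    using detectable_lyapunov_hurwitz[OF assms(1,2,3) P(1) V eq] .
  have W: "psd (Q + transpose K' ** R ** K')"
    using assms pd_imp_psd psd_congruence psd_add by blast
  then obtain P' where P': "transpose P' = P'"
      "transpose ?M' ** P' + P' ** ?M' = - (Q + transpose K' ** R ** K')"
    using lyapunov_equation_solvable[OF hur] by (metis psd_def)
  have "psd P'"
    using lyapunov_equation_psd[OF hur P'] W by (simp add: psd_def)
  moreover have "transpose (P - P') = P - P'" by (simp add: transpose_distribs sym P')
  moreover have "transpose ?M' ** (P - P') + (P - P') ** ?M' = - V"
  proof -
    have "transpose ?M' ** (P - P') + (P - P') ** ?M'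
        = (transpose ?M' ** P + P ** ?M') - (transpose ?M' ** P' + P' ** ?M')"
      by (simp only: matrix_diff_ldist matrix_diff_rdist) simp
    then show ?thesis unfolding eq P'(2) by simp
  qed
  ultimately show thesis
    using that hur P' lyapunov_equation_psd[OF hur] V by (metis psd_def)
qed

text \<open>The costs of policy iteration decrease to a limit whose improved gain has that same
  limit as its cost; this fixed point is the Riccati solution.\<close>

lemma lqr_solution:
  fixes A :: "real^'n^'n" and B :: "real^'m^'n"
  assumes Q: "psd Q" and R: "pd R" and A: "undetected_stable Q A" and "stabilizable A B"
  obtains K P where "psd P" "hurwitz (A + B ** K)" "R ** K + transpose B ** P = 0"
    "transpose (A + B ** K) ** P + P ** (A + B ** K) = - (Q + transpose K ** R ** K)"
proof -
  obtain R' where R': "R ** R' = mat 1" "R' ** R = mat 1" using pd_invertible[OF R] by blast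
  define I where "I K P \<longleftrightarrow> psd P \<and>
    transpose (A + B ** K) ** P + P ** (A + B ** K) = - (Q + transpose K ** R ** K)" for K :: "real^'n^'m" and P :: "real^'n^'n"
  define nx where "nx P = - (R' ** (transpose B ** P))" for P :: "real^'n^'n"
  have nx: "R ** nx P = - (transpose B ** P)" for P
    using R' by (simp add: nx_def matrix_distribs matrix_mul_assoc)
  have "\<exists>f. \<forall>n. (case f n of (K, P) \<Rightarrow> I K P) \<and>
      (case (f n, f (Suc n)) of ((K, P), (K', P')) \<Rightarrow> K' = nx P \<and> psd (P - P'))"
  proof (rule dependent_nat_choice)
    obtain K :: "real^'n^'m" where K: "hurwitz (A + B ** K)"
      using \<open>stabilizable A B\<close> by (auto simp: stabilizable_def)
    have W: "psd (Q + transpose K ** R ** K)"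
      using Q R pd_imp_psd psd_congruence psd_add by blast
    then obtain P where P: "transpose P = P"
        "transpose (A + B ** K) ** P + P ** (A + B ** K) = - (Q + transpose K ** R ** K)"
      using lyapunov_equation_solvable[OF K] by (metis psd_def)
    then have "psd P" using lyapunov_equation_psd[OF K P] W by (simp add: psd_def)
    with P show "\<exists>x. case x of (K, P) \<Rightarrow> I K P" by (auto simp: I_def)
  next
    fix x n
    assume "case x of (K, P) \<Rightarrow> I K P"
    then obtain K P where x: "x = (K, P)" "I K P" by auto
    then obtain P' where "psd P'" "psd (P - P')"
        "transpose (A + B ** nx P) ** P' + P' ** (A + B ** nx P) = - (Q + transpose (nx P) ** R ** nx P)"
      using lqr_policy_step[OF Q R A _ _ nx] unfolding I_def by metis
    then show "\<exists>y. (case y of (K, P) \<Rightarrow> I K P) \<and>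
        (case (x, y) of ((K, P), (K', P')) \<Rightarrow> K' = nx P \<and> psd (P - P'))"
      using x by (intro exI[of _ "(nx P, P')"]) (simp add: I_def)
  qed
  then obtain f where f: "\<And>n. I (fst (f n)) (snd (f n))" "\<And>n. fst (f (Suc n)) = nx (snd (f n))"
      "\<And>n. psd (snd (f n) - snd (f (Suc n)))"
    by (auto simp: split_beta)
  define Ps where "Ps n = snd (f n)" for n
  have "convergent Ps"
    using f by (intro decreasing_psd_convergent) (auto simp: Ps_def I_def)
  then obtain P where P: "Ps \<longlonglongrightarrow> P" by (auto simp: convergent_def)
  define K where "K = nx P"
  note tm = bounded_bilinear.tendsto[OF bounded_bilinear_matrix_mult] bounded_linear.tendsto[OF bounded_linear_transpose]
  \<comment> \<open>The gain at index \<open>Suc n\<close> is computed from the cost at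
    \<open>n\<close> and has its own cost at \<open>Suc n\<close>. Both costs tend to
    \<open>P\<close>, which closes the loop in the limit.\<close>
  have Klim: "(\<lambda>n. fst (f (Suc n))) \<longlonglongrightarrow> K"
    unfolding f(2) K_def nx_def by (intro tendsto_intros tm P[unfolded Ps_def])
  have Plim: "(\<lambda>n. snd (f (Suc n))) \<longlonglongrightarrow> P"
    using LIMSEQ_Suc[OF P] by (simp add: Ps_def)
  have "psd P" by (rule psd_limit[OF P]) (use f in \<open>auto simp: Ps_def I_def\<close>)
  have e1: "transpose (A + B ** K) ** P + P ** (A + B ** K) = - (Q + transpose K ** R ** K)"
  proof (rule LIMSEQ_unique)
    let ?K = "\<lambda>n. fst (f (Suc n))" and ?P = "\<lambda>n. snd (f (Suc n))"
    show "(\<lambda>n. transpose (A + B ** ?K n) ** ?P n + ?P n ** (A + B ** ?K n))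
        \<longlonglongrightarrow> transpose (A + B ** K) ** P + P ** (A + B ** K)"
      by (intro tendsto_intros tm Klim Plim)
    have "transpose (A + B ** ?K n) ** ?P n + ?P n ** (A + B ** ?K n) = - (Q + transpose (?K n) ** R ** ?K n)" for n
      using f(1)[of "Suc n"] by (simp add: I_def)
    then show "(\<lambda>n. transpose (A + B ** ?K n) ** ?P n + ?P n ** (A + B ** ?K n))
        \<longlonglongrightarrow> - (Q + transpose K ** R ** K)"
      by (simp only:) (intro tendsto_intros tm Klim)
  qed
  \<comment> \<open>Being Hurwitz is not preserved by limits, so detectability is applied once more,
    now to the limit equation with zero surplus.\<close>
  have "psd (0 :: real^'n^'n)" by (simp add: psd_def transpose_zero)
  then have "hurwitz (A + B ** K)"
    using detectable_lyapunov_hurwitz[OF Q R A \<open>psd P\<close>, of 0 B K] e1 by simp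
  moreover have "R ** K + transpose B ** P = 0" by (simp add: K_def nx)
  ultimately show thesis using that \<open>psd P\<close> e1 by blast
qed

subsection \<open>Square roots and resolvent bounds\<close>

text \<open>The Riccati equation with \<open>A = 0\<close> and \<open>B = R = 1\<close> reads \<open>P\<^sup>2 = Q\<close>.\<close>

lemma pd_has_sqrt:
  fixes Q :: "real^'n^'n"
  assumes "pd Q"
  shows "\<exists>S. psd S \<and> S ** S = Q"
proof -
  have pd1: "pd (mat 1 :: real^'n^'n)" by (simp add: pd_def)
  have neg: "(- mat 1) *v x = - x" for x :: "real^'n"
    using matrix_vector_mult_diff_rdistrib[of 0 "mat 1" x] by simp
  have "lyapunov_for (- mat 1 :: real^'n^'n) (mat 1)"
    using pd1 by (simp add: lyapunov_for_def neg)
  then have "hurwitz (0 + mat 1 ** (- mat 1) :: real^'n^'n)"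
    using lyapunov_imp_hurwitz by simp
  then have "stabilizable (0 :: real^'n^'n) (mat 1 :: real^'n^'n)"
    unfolding stabilizable_def by blast
  moreover have "undetected_stable Q 0"
    unfolding undetected_stable_def using assms by (metis inner_zero_right less_irrefl pd_def)
  ultimately obtain K P :: "real^'n^'n" where P: "psd P" "mat 1 ** K + transpose (mat 1) ** P = 0"
      "transpose (0 + mat 1 ** K) ** P + P ** (0 + mat 1 ** K) = - (Q + transpose K ** mat 1 ** K)"
    using lqr_solution[OF pd_imp_psd[OF assms] pd1] by metis
  from P(2) have "K = - P" by (simp add: eq_neg_iff_add_eq_0)
  moreover have "transpose P = P" using P(1) by (simp add: psd_def)
  ultimately have "P ** P = Q" using P(3) by (simp add: matrix_distribs transpose_distribs)
  with P(1) show ?thesis by blast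
qed

lemma norm_matrix_le_entries: "norm M \<le> (\<Sum>i\<in>UNIV. \<Sum>j\<in>UNIV. \<bar>M $ i $ j\<bar>)" for M :: "real^'n^'m"
proof -
  have "norm M \<le> (\<Sum>i\<in>UNIV. norm (M $ i))"
    unfolding norm_vec_def by (rule L2_set_le_sum) simp
  also have "\<dots> \<le> (\<Sum>i\<in>UNIV. \<Sum>j\<in>UNIV. \<bar>M $ i $ j\<bar>)"
    by (intro sum_mono norm_le_l1_cart)
  finally show ?thesis .
qed

text \<open>For singular \<open>Q\<close>, a kernel vector is an undetected eigenvector of the zero
  matrix, so the Riccati construction does not apply directly. Roots of the shifts Q + I/(n+1) are
  taken instead, and compactness yields a limit point.\<close>

lemma psd_has_sqrt:
  fixes Q :: "real^'n^'n"
  assumes "psd Q"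
  shows "\<exists>S. psd S \<and> S ** S = Q"
proof -
  define Qn where "Qn n = Q + inverse (real (Suc n)) *\<^sub>R mat 1" for n
  have scal: "x \<bullet> ((c *\<^sub>R mat 1) *v x) = c * (x \<bullet> x)" for c and x :: "real^'n"
    by (simp flip: scaleR_matrix_vector_assoc)
  have "pd (Qn n)" for n
    unfolding pd_def
  proof (intro conjI allI impI)
    show "transpose (Qn n) = Qn n"
      using assms by (simp add: Qn_def psd_def transpose_distribs)
    fix x :: "real^'n" assume "x \<noteq> 0"
    then have "0 < inverse (real (Suc n)) * (x \<bullet> x)" by simp
    moreover have "0 \<le> x \<bullet> (Q *v x)" using assms by (simp add: psd_def)
    ultimately show "0 < x \<bullet> (Qn n *v x)"
      unfolding Qn_def matrix_vector_mult_add_rdistrib inner_add_right scal by linarith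
  qed
  then have "\<forall>n. \<exists>S. psd S \<and> S ** S = Qn n"
    using pd_has_sqrt by blast
  then obtain S where S: "\<And>n. psd (S n)" "\<And>n. S n ** S n = Qn n"
    by (auto dest!: choice)
  \<comment> \<open>Column j of \<open>S n\<close> has squared length (Qn)_jj, at most Q_jj + 1; the
    estimate t <= t^2 + 1 adds the other 1.\<close>
  have entry: "\<bar>S n $ i $ j\<bar> \<le> Q $ j $ j + 2" for n i j
  proof -
    have "(norm (S n *v axis j 1))\<^sup>2 = axis j 1 \<bullet> (S n *v (S n *v axis j 1))"
      using inner_matrix_vector[of "axis j 1" "S n" "S n *v axis j 1"] S(1)[of n]
      by (simp add: psd_def power2_norm_eq_inner del: transpose_matrix_vector)
    also have "\<dots> = Qn n $ j $ j"
      by (simp add: matrix_vector_mul_assoc S(2) flip: matrix_entry_inner)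
    also have "\<dots> \<le> Q $ j $ j + 1"
      by (simp add: Qn_def mat_def inverse_le_1_iff)
    finally have sq: "(norm (S n *v axis j 1))\<^sup>2 \<le> Q $ j $ j + 1" .
    have "\<bar>S n $ i $ j\<bar> \<le> norm (S n *v axis j 1)"
      unfolding matrix_entry_inner
      using Cauchy_Schwarz_ineq2[of "axis i 1" "S n *v axis j 1"] by (simp add: norm_axis_1)
    also have "\<dots> \<le> (norm (S n *v axis j 1))\<^sup>2 + 1"
      using sum_power2_ge_zero[of "norm (S n *v axis j 1) - 1/2" 0]
      by (simp add: power2_eq_square algebra_simps)
    finally show ?thesis using sq by simp
  qed
  define b where "b = (\<Sum>i\<in>(UNIV::'n set). \<Sum>j\<in>UNIV. Q $ j $ j + 2)"
  have "S n \<in> cball 0 b" for n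
  proof -
    have "(\<Sum>i\<in>UNIV. \<Sum>j\<in>UNIV. \<bar>S n $ i $ j\<bar>) \<le> b"
      unfolding b_def by (intro sum_mono entry)
    with norm_matrix_le_entries[of "S n"] show ?thesis by simp
  qed
  then obtain L r where L: "strict_mono (r :: nat \<Rightarrow> nat)" "(S \<circ> r) \<longlonglongrightarrow> L"
    using compact_imp_seq_compact[OF compact_cball] unfolding seq_compact_def by blast
  have "psd L" using psd_limit[OF L(2)] S(1) by simp
  moreover have "L ** L = Q"
  proof (rule LIMSEQ_unique)
    show "(\<lambda>n. (S \<circ> r) n ** (S \<circ> r) n) \<longlonglongrightarrow> L ** L"
      by (rule bounded_bilinear.tendsto[OF bounded_bilinear_matrix_mult L(2) L(2)])
    have "Qn \<longlonglongrightarrow> Q + 0 *\<^sub>R mat 1"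
      unfolding Qn_def by (intro tendsto_intros LIMSEQ_inverse_real_of_nat)
    then show "(\<lambda>n. (S \<circ> r) n ** (S \<circ> r) n) \<longlonglongrightarrow> Q"
      using LIMSEQ_subseq_LIMSEQ[OF _ L(1), of Qn Q] by (simp add: S(2) o_def)
  qed
  ultimately show ?thesis by blast
qed

section \<open>Uniqueness of the square root\<close>

lemma trace_inner: "trace M = (\<Sum>i\<in>UNIV. axis i 1 \<bullet> (M *v axis i 1))" for M :: "real^'n^'n"
  by (simp add: trace_def flip: matrix_entry_inner)

lemma sym_square_kernel:
  fixes D :: "real^'n^'n"
  assumes "transpose D = D" "D *v (D *v x) = 0"
  shows "D *v x = 0"
  using inner_matrix_vector[of x D "D *v x"] assms by (simp del: transpose_matrix_vector)

text \<open>With D = S - T, equality of the squares reads S D + D T = 0. Multiplying by D and taking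
  the trace gives trace (D S D) + trace (D T D) = 0, a sum of nonnegative terms over the columns of
  D.\<close>

lemma psd_sqrt_unique:
  fixes S T :: "real^'n^'n"
  assumes S: "psd S" and T: "psd T" and eq: "S ** S = T ** T"
  shows "S = T"
proof -
  define D where "D = S - T"
  have sym: "transpose D = D" using S T by (simp add: D_def psd_def transpose_distribs)
  have "S ** D + D ** T = 0"
    unfolding D_def by (simp add: matrix_diff_ldist matrix_diff_rdist eq)
  then have "0 = trace (D ** (S ** D + D ** T))" by (simp add: trace_def)
  also have "\<dots> = trace (D ** S ** D) + trace (D ** T ** D)"
    by (simp add: matrix_add_ldistrib trace_add matrix_mul_assoc trace_mul_sym[of "D ** D" T])
      (simp add: trace_mul_sym[of _ D] matrix_mul_assoc)
  also have "\<dots> = (\<Sum>i\<in>UNIV. (D *v axis i 1) \<bullet> (S *v (D *v axis i 1)) + (D *v axis i 1) \<bullet> (T *v (D *v axis i 1)))"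
    using congruence_form[of _ D S] congruence_form[of _ D T] by (simp add: trace_inner sym sum.distrib)
  finally have sum0: "(\<Sum>i\<in>UNIV. (D *v axis i 1) \<bullet> (S *v (D *v axis i 1)) + (D *v axis i 1) \<bullet> (T *v (D *v axis i 1))) = 0"
    by simp
  have nn: "0 \<le> x \<bullet> (S *v x)" "0 \<le> x \<bullet> (T *v x)" for x using S T by (auto simp: psd_def)
  have "D *v axis i 1 = 0" for i
  proof -
    let ?x = "D *v axis i 1"
    have "?x \<bullet> (S *v ?x) + ?x \<bullet> (T *v ?x) = 0"
      using sum0 nn by (subst (asm) sum_nonneg_eq_0_iff) (auto simp: add_nonneg_nonneg)
    with nn[of ?x] have "?x \<bullet> (S *v ?x) = 0" "?x \<bullet> (T *v ?x) = 0" by linarith+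
    then have "S *v ?x = 0" "T *v ?x = 0" using psd_kernel S T by blast+
    then have "D *v ?x = 0" by (simp add: D_def matrix_vector_mult_diff_rdistrib)
    with sym show ?thesis by (rule sym_square_kernel)
  qed
  then have "D $ i $ j = 0" for i j by (simp add: matrix_entry_inner)
  then have "D = 0" by (simp add: vec_eq_iff)
  then show ?thesis by (simp add: D_def)
qed

lemma psd_sqrt_props:
  assumes "psd Q"
  shows "psd (psd_sqrt Q)" "psd_sqrt Q ** psd_sqrt Q = Q"
proof -
  have "\<exists>!S. psd S \<and> S ** S = Q"
    using psd_has_sqrt[OF assms] psd_sqrt_unique by blast
  from theI'[OF this] show "psd (psd_sqrt Q)" "psd_sqrt Q ** psd_sqrt Q = Q"
    unfolding psd_sqrt_def by auto
qed

text \<open>\<open>Q\<close> and its root have the same kernel; on it the output injection vanishes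
  and \<open>A\<close> agrees with a Hurwitz matrix.\<close>

lemma detectable_undetected_stable:
  fixes A Q :: "real^'n^'n"
  assumes "psd Q" "detectable (psd_sqrt Q) A"
  shows "undetected_stable Q A"
proof -
  obtain L where L: "hurwitz (A + L ** psd_sqrt Q)" using assms(2) by (auto simp: detectable_def)
  have "psd_sqrt Q *v x = 0" if "Q *v x = 0" for x
    using that psd_sqrt_props[OF assms(1)] sym_square_kernel[of "psd_sqrt Q" x]
    by (simp add: psd_def matrix_vector_mul_assoc)
  then have eq: "(A + L ** psd_sqrt Q) *v x = A *v x" if "Q *v x = 0" for x
    using that by (simp add: matrix_vector_mult_add_rdistrib flip: matrix_vector_mul_assoc)
  show ?thesis
    unfolding undetected_stable_def
  proof (intro allI impI)
    fix \<alpha> \<beta> a b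
    assume h: "A *v a = \<alpha> *\<^sub>R a - \<beta> *\<^sub>R b" "A *v b = \<alpha> *\<^sub>R b + \<beta> *\<^sub>R a" "Q *v a = 0" "Q *v b = 0" "0 \<le> \<alpha>"
    show "a = 0 \<and> b = 0"
      using L[unfolded hurwitz_iff_real, rule_format, of a \<alpha> \<beta> b] h by (simp add: eq)
  qed
qed

section \<open>Frequency-domain bounds\<close>

definition re :: "complex^'n \<Rightarrow> real^'n" where "re x = (\<chi> i. Re (x $ i))"
definition im :: "complex^'n \<Rightarrow> real^'n" where "im x = (\<chi> i. Im (x $ i))"

lemma re_cmat: "re (cmat M *v x) = M *v re x" and im_cmat: "im (cmat M *v x) = M *v im x"
  by (simp_all add: re_def im_def cmat_def matrix_vector_mult_def vec_eq_iff)

lemma norm_re_im: "(norm x)\<^sup>2 = (norm (re x))\<^sup>2 + (norm (im x))\<^sup>2"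
  by (simp add: power2_norm_eq_inner inner_vec_def re_def im_def inner_complex_def sum.distrib)

lemma norm_cmat_le:
  assumes "\<And>y. norm (M *v y) \<le> c * norm y" "0 \<le> c"
  shows "norm (cmat M *v x) \<le> c * norm x"
proof -
  have "(norm (cmat M *v x))\<^sup>2 \<le> (c * norm (re x))\<^sup>2 + (c * norm (im x))\<^sup>2"
    unfolding norm_re_im[of "cmat M *v x"] re_cmat im_cmat
    by (intro add_mono power_mono assms) auto
  also have "\<dots> = (c * norm x)\<^sup>2"
    by (simp add: norm_re_im[of x] power_mult_distrib algebra_simps)
  finally show ?thesis using assms(2) by (simp add: abs_le_square_iff[symmetric])
qed

text \<open>Pair the resolvent equation with P x and take real parts: by symmetry of
  \<open>P\<close> the term with i w drops out, so the bound holds at all frequencies. The 2 comes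
  from estimating real and imaginary parts separately.\<close>

lemma resolvent_bound:
  fixes N P :: "real^'n^'n"
  assumes "transpose P = P" and c: "0 < c" "\<And>x. x \<bullet> (P *v (N *v x)) \<le> - c * (norm x)\<^sup>2"
    and p: "\<And>x. norm (P *v x) \<le> p * norm x" "0 \<le> p"
    and eq: "(mat (\<i> * complex_of_real w) - cmat N) *v x = y"
  shows "norm x \<le> 2 * p / c * norm y"
proof (cases "x = 0")
  case False
  let ?a = "re x" and ?b = "im x"
  have y: "y = (\<i> * complex_of_real w) *s x - cmat N *v x"
    using eq by (simp add: matrix_vector_mult_diff_rdistrib mat_mult_vector)
  have "re y = - (w *\<^sub>R ?b) - N *v ?a" "im y = w *\<^sub>R ?a - N *v ?b"
    unfolding re_cmat[symmetric] im_cmat[symmetric] y by (simp_all add: re_def im_def vec_eq_iff)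
  then have N: "N *v ?a = - (w *\<^sub>R ?b) - re y" "N *v ?b = w *\<^sub>R ?a - im y" by auto
  have sym: "?a \<bullet> (P *v ?b) = ?b \<bullet> (P *v ?a)"
    using inner_matrix_vector[of ?a P ?b] assms(1) by (simp add: inner_commute del: transpose_matrix_vector)
  have neg: "P *v (- u) = - (P *v u)" for u
    using matrix_vector_mult_diff_distrib[of P 0 u] by simp
  have "?a \<bullet> (P *v (N *v ?a)) + ?b \<bullet> (P *v (N *v ?b)) = - (?a \<bullet> (P *v re y) + ?b \<bullet> (P *v im y))"
    unfolding N by (simp add: matrix_vector_mult_diff_distrib neg matrix_vector_mult_scaleR
        inner_diff_right sym)
  with c(2)[of ?a] c(2)[of ?b] have "c * (norm x)\<^sup>2 \<le> ?a \<bullet> (P *v re y) + ?b \<bullet> (P *v im y)"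
    by (simp add: norm_re_im[of x] algebra_simps)
  also have "\<dots> \<le> norm ?a * (p * norm (re y)) + norm ?b * (p * norm (im y))"
    by (intro add_mono order_trans[OF norm_cauchy_schwarz] mult_left_mono p) auto
  also have "\<dots> \<le> norm x * (p * norm y) + norm x * (p * norm y)"
  proof -
    have "norm (re z) \<le> norm z" "norm (im z) \<le> norm z" for z :: "complex^'n"
      by (rule power2_le_imp_le; simp add: norm_re_im[of z])+
    then show ?thesis by (intro add_mono mult_mono) (auto simp: p)
  qed
  finally have "norm x * (c * norm x) \<le> norm x * (2 * p * norm y)"
    by (simp add: power2_eq_square algebra_simps)
  then have "c * norm x \<le> 2 * p * norm y" using False by simp
  then show ?thesis using c(1) by (simp add: field_simps)
qed (use c p in simp)

text \<open>A Lyapunov matrix for \<open>K0\<close> also serves nearby gains, so the resolvent bound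
  is uniform in \<open>K\<close>. All stabilizing gains near \<open>K0\<close> thus enter
  \<open>Kbeta\<close> once \<beta> exceeds \<open>h\<close>.\<close>

lemma hinf_norm_locally_bounded:
  fixes A :: "real^'n^'n" and B :: "real^'m^'n" and K0 :: "real^'n^'m"
  assumes "hurwitz (AK A B K0)"
  shows "\<exists>\<delta>>0. \<exists>h. \<forall>K. dist K K0 < \<delta> \<longrightarrow> hurwitz (AK A B K) \<longrightarrow> hinf_norm A B Bw Qinf Rinf K \<le> h"
proof -
  obtain P where P: "lyapunov_for (AK A B K0) P" using hurwitz_imp_lyapunov assms by blast
  then have symP: "transpose P = P" by (simp add: lyapunov_for_def pd_def)
  obtain c e where ce: "c > 0" "e > 0"
      "\<And>N x. dist N (AK A B K0) < e \<Longrightarrow> x \<bullet> (P *v (N *v x)) \<le> - c * (norm x)\<^sup>2"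
    using lyapunov_for_nhd[OF P] by blast
  have "isCont (AK A B) K0"
    unfolding AK_def by (intro continuous_intros bounded_bilinear.isCont[OF bounded_bilinear_matrix_mult])
  then obtain d where d: "d > 0" "\<And>K. dist K K0 < d \<Longrightarrow> dist (AK A B K) (AK A B K0) < e"
    using ce(2) unfolding continuous_at_eps_delta by metis
  define s where "s M = (SOME c. 0 \<le> c \<and> (\<forall>x. norm (M *v x) \<le> c * norm x))" for M :: "real^'n^'n"
  have s: "0 \<le> s M" "norm (M *v x) \<le> s M * norm x" for M x
  proof -
    have "\<exists>c\<ge>0. \<forall>x. norm (M *v x) \<le> c * norm x"
      using bounded_linear.nonneg_bounded[OF matrix_vector_mul_bounded_linear[of M]]
      by (metis mult.commute)
    from someI_ex[OF this] show "0 \<le> s M" "norm (M *v x) \<le> s M * norm x"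
      unfolding s_def by auto
  qed
  obtain k1 where k1: "k1 > 0" "\<And>(M::real^'n^'m) x. norm (M *v x) \<le> norm M * norm x * k1"
    using bounded_bilinear.pos_bounded[OF bounded_bilinear_matrix_vector_mult] by blast
  obtain k2 where k2: "k2 > 0" "\<And>(M::real^'m^'m) (K::real^'n^'m). norm (M ** K) \<le> norm M * norm K * k2"
    using bounded_bilinear.pos_bounded[OF bounded_bilinear_matrix_mult] by blast
  define Rs where "Rs = psd_sqrt Rinf"
  define r where "r = norm Rs * (norm K0 + 1) * k2 * k1"
  have r: "0 \<le> r" using k1 k2 by (simp add: r_def)
  define X where "X = 2 * s P / c * s Bw"
  have X: "0 \<le> X" using s ce(1) by (simp add: X_def)
  define h where "h = sqrt ((s (psd_sqrt Qinf) * X)\<^sup>2 + (r * X)\<^sup>2)"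
  have "hinf_norm A B Bw Qinf Rinf K \<le> h" if K: "dist K K0 < min d 1" and hur: "hurwitz (AK A B K)" for K
  proof -
    have RsK: "norm ((Rs ** K) *v x) \<le> r * norm x" for x
    proof -
      have "norm K \<le> norm K0 + 1"
        using K norm_triangle_sub[of K K0] by (simp add: dist_norm)
      then have "norm (Rs ** K) \<le> norm Rs * (norm K0 + 1) * k2"
        using k2 by (intro order_trans[OF k2(2)] mult_right_mono mult_left_mono) auto
      then have "norm (Rs ** K) * norm x * k1 \<le> norm Rs * (norm K0 + 1) * k2 * norm x * k1"
        using k1 by (intro mult_right_mono) auto
      with k1(2)[of "Rs ** K" x] show ?thesis by (simp add: r_def mult_ac)
    qed
    have T: "Tinf_apply A B Bw Qinf Rinf K (\<i> * complex_of_real w) v \<le> h" if v: "norm v = 1" for w v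
    proof -
      define D where "D = mat (\<i> * complex_of_real w) - cmat (AK A B K)"
      define x where "x = matrix_inv D *v (cmat Bw *v v)"
      have "det D \<noteq> 0" using hur unfolding hurwitz_def D_def by fastforce
      then have "invertible D" using invertible_det_nz by blast
      then have "D ** matrix_inv D = mat 1"
        unfolding invertible_def matrix_inv_def by (rule someI2_ex) simp
      then have Dx: "D *v x = cmat Bw *v v"
        by (simp add: x_def matrix_vector_mul_assoc matrix_mul_assoc)
      have "dist (AK A B K) (AK A B K0) < e" using K d(2) by auto
      from resolvent_bound[OF symP ce(1) ce(3)[OF this] s(2) s(1) Dx[unfolded D_def]]
      have "norm x \<le> 2 * s P / c * norm (cmat Bw *v v)" .
      also have "\<dots> \<le> 2 * s P / c * (s Bw * norm v)"
        using s ce(1) by (intro mult_left_mono norm_cmat_le) auto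
      finally have x: "norm x \<le> X" by (simp add: X_def v)
      have "norm (cmat (psd_sqrt Qinf) *v x) \<le> s (psd_sqrt Qinf) * X"
        using s x by (intro order_trans[OF norm_cmat_le[OF s(2)]] mult_left_mono) auto
      moreover have "norm (cmat (Rs ** K) *v x) \<le> r * X"
        using r x by (intro order_trans[OF norm_cmat_le[OF RsK]] mult_left_mono) auto
      ultimately show ?thesis
        unfolding Tinf_apply_def Let_def D_def[symmetric] x_def[symmetric] Rs_def[symmetric] h_def
        by (intro real_sqrt_le_mono add_mono power_mono) auto
    qed
    obtain v :: "complex^'n" where "norm v = 1" using vector_choose_size[of 1] by auto
    then show ?thesis
      unfolding hinf_norm_def by (intro cSUP_least) (auto intro: T)
  qed
  with d(1) show ?thesis by (intro exI[of _ "min d 1"]) auto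
qed

subsection \<open>The stabilizing Riccati solution\<close>

lemmas has_derivative_matrix_mult [derivative_intros] =
  bounded_bilinear.FDERIV[OF bounded_bilinear_matrix_mult]
lemmas has_derivative_transpose [derivative_intros] =
  bounded_linear.has_derivative[OF bounded_linear_transpose]
lemmas has_derivative_trace [derivative_intros] =
  bounded_linear.has_derivative[OF bounded_linear_trace]

lemmas continuous_on_matrix_mult [continuous_intros] =
  bounded_bilinear.continuous_on[OF bounded_bilinear_matrix_mult]
lemmas continuous_on_transpose [continuous_intros] =
  bounded_linear.continuous_on[OF bounded_linear_transpose]

lemma trace_transpose: "trace (transpose M) = trace M"
  by (simp add: trace_def transpose_def)

text \<open>Supplies the right inverse of a derivative that the inverse function and open mapping
  theorems ask for.\<close>

lemma linear_injective_right_inverse: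
  fixes f :: "'a::euclidean_space \<Rightarrow> 'a"
  assumes "linear f" "\<And>x. f x = 0 \<Longrightarrow> x = 0"
  obtains g where "bounded_linear g" "f \<circ> g = id"
proof -
  have "inj f" using assms linear_injective_0 by blast
  then obtain g where "linear g" "\<forall>x. f (g x) = x"
    using linear_injective_isomorphism[OF assms(1)] by auto
  with that show thesis by (simp add: fun_eq_iff linear_conv_bounded_linear)
qed

lemma continuous_on_AK [continuous_intros]:
  "continuous_on T K \<Longrightarrow> continuous_on T (\<lambda>p. AK A B (K p))"
  unfolding AK_def by (intro continuous_intros)

lemma continuous_on_SK [continuous_intros]:
  "continuous_on T K \<Longrightarrow> continuous_on T (\<lambda>p. SK Q R (K p))"
  unfolding SK_def by (intro continuous_intros)

text \<open>\<open>e\<close> stands for \<open>inverse (\<beta>\<^sup>2)\<close> but is a free real,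
  so that 0, the LQR case, is available.\<close>

definition Acl where
  "Acl A B Q R e X K = AK A B K + e *\<^sub>R (X ** SK Q R K)"

definition riccati where
  "riccati A B Bw Q R e X K =
     AK A B K ** X + X ** transpose (AK A B K) + e *\<^sub>R (X ** SK Q R K ** X) + Bw ** transpose Bw"

lemma AK_has_derivative [derivative_intros]:
  "(K has_derivative K') (at p within s) \<Longrightarrow>
    ((\<lambda>p. AK A B (K p)) has_derivative (\<lambda>h. B ** K' h)) (at p within s)"
  unfolding AK_def
  by (auto intro!: derivative_eq_intros simp: fun_eq_iff)

lemma SK_has_derivative [derivative_intros]:
  "(K has_derivative K') (at p within s) \<Longrightarrow> ((\<lambda>p. SK Q R (K p)) has_derivative
     (\<lambda>h. transpose (K' h) ** R ** K p + transpose (K p) ** R ** K' h)) (at p within s)"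
  unfolding SK_def
  by (auto intro!: derivative_eq_intros simp: fun_eq_iff)

lemma riccati_has_derivative:
  assumes "(e has_derivative e') (at p)" "(X has_derivative X') (at p)" "(K has_derivative K') (at p)"
  shows "((\<lambda>p. riccati A B Bw Q R (e p) (X p) (K p)) has_derivative
    (\<lambda>h. AK A B (K p) ** X' h + B ** K' h ** X p + X' h ** transpose (AK A B (K p))
      + X p ** transpose (B ** K' h) + e' h *\<^sub>R (X p ** SK Q R (K p) ** X p)
      + e p *\<^sub>R (X' h ** SK Q R (K p) ** X p
        + X p ** (transpose (K' h) ** R ** K p + transpose (K p) ** R ** K' h) ** X p
        + X p ** SK Q R (K p) ** X' h))) (at p)"
  unfolding riccati_def
  by (rule derivative_eq_intros assms refl)+
    (simp add: fun_eq_iff matrix_distribs scaleR_add_right)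

lemma Acl_has_derivative:
  assumes "(e has_derivative e') (at p)" "(X has_derivative X') (at p)" "(K has_derivative K') (at p)"
  shows "((\<lambda>p. Acl A B Q R (e p) (X p) (K p)) has_derivative
    (\<lambda>h. B ** K' h + e' h *\<^sub>R (X p ** SK Q R (K p)) + e p *\<^sub>R (X' h ** SK Q R (K p)
        + X p ** (transpose (K' h) ** R ** K p + transpose (K p) ** R ** K' h)))) (at p)"
  unfolding Acl_def
  by (rule derivative_eq_intros assms refl)+
    (simp add: fun_eq_iff matrix_distribs scaleR_add_right)

section \<open>Symmetry and uniqueness for the Riccati equation\<close>

lemma transpose_SK: "transpose Q = Q \<Longrightarrow> transpose R = R \<Longrightarrow> transpose (SK Q R K) = SK Q R K"
  by (simp add: SK_def transpose_distribs matrix_mul_assoc)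

text \<open>Splitting X S X - Y S Y as X S (X - Y) + (X - Y) S Y gives the difference Sylvester
  form, so \<open>sylvester_unique\<close> applies although the equation is quadratic.\<close>

lemma riccati_diff:
  "riccati A B Bw Q R e X K - riccati A B Bw Q R e Y K =
     Acl A B Q R e X K ** (X - Y) + (X - Y) ** (transpose (AK A B K) + e *\<^sub>R (SK Q R K ** Y))"
  by (simp add: riccati_def Acl_def matrix_distribs matrix_scalar_ac scalar_matrix_assoc[symmetric]
      matrix_mul_assoc algebra_simps)

lemma transpose_Acl:
  assumes "transpose Q = Q" "transpose R = R"
  shows "transpose (Acl A B Q R e X K) = transpose (AK A B K) + e *\<^sub>R (SK Q R K ** transpose X)"
  by (simp add: Acl_def transpose_distribs transpose_SK assms)

lemma transpose_riccati:
  assumes "transpose Q = Q" "transpose R = R"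
  shows "transpose (riccati A B Bw Q R e X K) = riccati A B Bw Q R e (transpose X) K"
  by (simp add: riccati_def transpose_distribs transpose_SK assms matrix_mul_assoc add.commute)

lemma psd_SK: "pd Q \<Longrightarrow> pd R \<Longrightarrow> psd (SK Q R K)"
  unfolding SK_def by (rule psd_add[OF pd_imp_psd psd_congruence[OF pd_imp_psd]])

text \<open>Comparing \<open>X\<close> with \<open>transpose X\<close>, which also solves the
  equation, yields symmetry. Moving the quadratic term to the right then leaves a Lyapunov equation
  for the Hurwitz \<open>AK A B K\<close> with semidefinite right-hand side.\<close>

lemma stabilizing_solution_psd:
  assumes Q: "pd Q" and R: "pd R" and "0 \<le> e" and hA: "hurwitz (AK A B K)"
    and hX: "hurwitz (Acl A B Q R e X K)" and X: "riccati A B Bw Q R e X K = 0"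
  shows "psd X"
proof -
  have sym: "transpose Q = Q" "transpose R = R" using Q R by (auto simp: pd_def)
  have "riccati A B Bw Q R e (transpose X) K = 0"
    using transpose_riccati[OF sym, of A B Bw e X K] X by (simp add: transpose_zero)
  then have "Acl A B Q R e X K ** (X - transpose X) + (X - transpose X) ** transpose (Acl A B Q R e X K) = 0"
    using riccati_diff[of A B Bw Q R e X K "transpose X"] X by (simp add: transpose_Acl sym)
  then have "X - transpose X = 0"
    using sylvester_unique hX hurwitz_transpose by blast
  then have symX: "transpose X = X" by simp
  define W where "W = e *\<^sub>R (X ** SK Q R K ** X) + Bw ** transpose Bw"
  have W: "psd W"
  proof -
    have "psd (transpose X ** SK Q R K ** X)" by (rule psd_congruence[OF psd_SK[OF Q R]])
    then have "psd (e *\<^sub>R (X ** SK Q R K ** X))"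
      using \<open>0 \<le> e\<close> by (simp add: symX psd_def transpose_scalar flip: scaleR_matrix_vector_assoc)
    moreover have "psd (Bw ** transpose Bw)"
      using psd_congruence[of "mat 1" "transpose Bw"] by (simp add: psd_def)
    ultimately show ?thesis unfolding W_def by (rule psd_add)
  qed
  have "transpose (transpose (AK A B K)) ** X + X ** transpose (AK A B K) = - W"
    unfolding eq_neg_iff_add_eq_0 using X by (simp add: riccati_def W_def add.assoc)
  then show ?thesis
    using lyapunov_equation_psd[of "transpose (AK A B K)" X W] hA symX W by (simp add: psd_def)
qed

lemma XK_eqI:
  assumes Q: "pd Q" and R: "pd R" and hA: "hurwitz (AK A B K)"
    and hX: "hurwitz (Acl A B Q R (inverse (\<beta>\<^sup>2)) X K)" and X: "riccati A B Bw Q R (inverse (\<beta>\<^sup>2)) X K = 0"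
  shows "XK A B Bw Q R \<beta> K = X"
  unfolding XK_def riccati_def[symmetric] Acl_def[symmetric]
proof (rule the_equality)
  have sym: "transpose Q = Q" "transpose R = R" using Q R by (auto simp: pd_def)
  show "psd X \<and> riccati A B Bw Q R (inverse (\<beta>\<^sup>2)) X K = 0 \<and> hurwitz (Acl A B Q R (inverse (\<beta>\<^sup>2)) X K)"
    using stabilizing_solution_psd[OF Q R _ hA hX X] hX X by simp
  fix Y
  assume Y: "psd Y \<and> riccati A B Bw Q R (inverse (\<beta>\<^sup>2)) Y K = 0 \<and> hurwitz (Acl A B Q R (inverse (\<beta>\<^sup>2)) Y K)"
  then have "transpose Y = Y" by (simp add: psd_def)
  then have "Acl A B Q R (inverse (\<beta>\<^sup>2)) X K ** (X - Y) + (X - Y) ** transpose (Acl A B Q R (inverse (\<beta>\<^sup>2)) Y K) = 0"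
    using riccati_diff[of A B Bw Q R "inverse (\<beta>\<^sup>2)" X K Y] X Y by (simp add: transpose_Acl sym)
  then have "X - Y = 0"
    using sylvester_unique hX hurwitz_transpose Y by blast
  then show "Y = X" by simp
qed

text \<open>Inverse function theorem for (X, K) |-> (\<open>riccati\<close>, K). The second
  conclusion is what lets a Lagrangian replace \<open>Jmix\<close> near \<open>K0\<close>.\<close>

lemma XK_differentiable:
  fixes A :: "real^'n^'n" and B :: "real^'m^'n" and K0 :: "real^'n^'m"
  assumes Q: "pd Q" and R: "pd R" and hA: "hurwitz (AK A B K0)"
    and hX: "hurwitz (Acl A B Q R (inverse (\<beta>\<^sup>2)) X0 K0)"
    and X0: "riccati A B Bw Q R (inverse (\<beta>\<^sup>2)) X0 K0 = 0"
  shows "\<exists>X'. (XK A B Bw Q R \<beta> has_derivative X') (at K0)"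
    and "\<forall>\<^sub>F K in nhds K0. riccati A B Bw Q R (inverse (\<beta>\<^sup>2)) (XK A B Bw Q R \<beta> K) K = 0"
proof -
  define e where "e = inverse (\<beta>\<^sup>2)"
  note hX = hX[folded e_def] and X0 = X0[folded e_def]
  have sym: "transpose Q = Q" "transpose R = R" using Q R by (auto simp: pd_def)
  have symX: "transpose X0 = X0"
    using stabilizing_solution_psd[OF Q R _ hA hX X0] by (simp add: e_def psd_def)
  define f where "f p = (riccati A B Bw Q R e (fst p) (snd p), snd p)" for p :: "(real^'n^'n) \<times> (real^'n^'m)"
  \<comment> \<open>The right coefficient in \<open>riccati_diff\<close>. For nonsymmetric
    \<open>fst p\<close> it is not the transposed closed loop, so its being Hurwitz is a separate
    condition; it makes \<open>f\<close> injective on \<open>S\<close>.\<close>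
  define N where "N p = transpose (AK A B (snd p)) + e *\<^sub>R (SK Q R (snd p) ** fst p)" for p :: "(real^'n^'n) \<times> (real^'n^'m)"
  define S where "S = (\<lambda>p. Acl A B Q R e (fst p) (snd p)) -` {M. hurwitz M} \<inter> N -` {M. hurwitz M} \<inter>
     (\<lambda>p. AK A B (snd p)) -` {M. hurwitz M}"
  have openS: "open S"
    unfolding S_def N_def Acl_def
    by (intro open_Int open_vimage open_hurwitz continuous_intros)
  have contf: "continuous_on S f"
    unfolding f_def riccati_def by (intro continuous_intros)
  have p0: "(X0, K0) \<in> S"
    using hX hA hX[folded hurwitz_transpose[of "Acl A B Q R e X0 K0"]] symX
    by (simp add: S_def N_def transpose_Acl sym)
  have inj: "inj_on f S"
  proof (rule inj_onI)
    fix p q assume pq: "p \<in> S" "q \<in> S" "f p = f q"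
    then have K: "snd p = snd q" by (simp add: f_def)
    have hur: "hurwitz (Acl A B Q R e (fst p) (snd p))" "hurwitz (N q)"
      using pq(1,2) by (auto simp: S_def)
    have "Acl A B Q R e (fst p) (snd p) ** (fst p - fst q) + (fst p - fst q) ** N q = 0"
      using riccati_diff[of A B Bw Q R e "fst p" "snd p" "fst q"] pq(3) K by (simp add: f_def N_def)
    then have "fst p - fst q = 0"
      using sylvester_unique[OF hur] by blast
    with K show "p = q" by (simp add: prod_eq_iff)
  qed
  define f' where "f' h = (AK A B K0 ** fst h + B ** snd h ** X0 + fst h ** transpose (AK A B K0)
      + X0 ** transpose (B ** snd h)
      + e *\<^sub>R (fst h ** SK Q R K0 ** X0
        + X0 ** (transpose (snd h) ** R ** K0 + transpose K0 ** R ** snd h) ** X0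
        + X0 ** SK Q R K0 ** fst h), snd h)" for h :: "(real^'n^'n) \<times> (real^'n^'m)"
  have derf: "(f has_derivative f') (at (X0, K0))"
    unfolding f_def f'_def
    using riccati_has_derivative[where p = "(X0, K0)" and A = A and B = B and Bw = Bw and Q = Q and R = R,
        OF has_derivative_const[of e] bounded_linear_imp_has_derivative[OF bounded_linear_fst]
        bounded_linear_imp_has_derivative[OF bounded_linear_snd]]
    by (intro has_derivative_Pair bounded_linear_imp_has_derivative[OF bounded_linear_snd]) simp
  have "h = 0" if "f' h = 0" for h
  proof -
    have K: "snd h = 0" using that by (simp add: f'_def prod_eq_iff)
    then have "Acl A B Q R e X0 K0 ** fst h + fst h ** transpose (Acl A B Q R e X0 K0) = 0"
      using that by (simp add: f'_def prod_eq_iff Acl_def transpose_distribs transpose_SK sym symX matrix_distribs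
          matrix_scalar_ac scalar_matrix_assoc[symmetric] scaleR_add_right matrix_mul_assoc transpose_zero algebra_simps)
    then have "fst h = 0" using sylvester_unique hX hurwitz_transpose by blast
    with K show ?thesis by (simp add: prod_eq_iff)
  qed
  then obtain g' where g': "bounded_linear g'" "f' \<circ> g' = id"
    using linear_injective_right_inverse has_derivative_linear[OF derf] by blast
  define g where "g = inv_into S f"
  have gf: "g (f p) = p" if "p \<in> S" for p
    using that inj by (simp add: g_def)
  have fp0: "f (X0, K0) = (0, K0)" by (simp add: f_def X0)
  have "(g has_derivative g') (at (0, K0))"
    using has_derivative_inverse_strong[OF openS p0 contf gf derf g'(2)] by (simp add: fp0)
  moreover have "((\<lambda>K. (0, K)) has_derivative (\<lambda>h. (0, h))) (at K0)"
    by (auto intro!: derivative_eq_intros)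
  ultimately have "(g \<circ> (\<lambda>K. (0, K)) has_derivative g' \<circ> (\<lambda>h. (0, h))) (at K0)"
    by (intro diff_chain_at)
  then have derg: "((\<lambda>K. fst (g (0, K))) has_derivative (\<lambda>h. fst (g' (0, h)))) (at K0)"
    unfolding o_def by (rule has_derivative_fst)
  \<comment> \<open>Openness puts \<open>(0, K)\<close> into the image of \<open>S\<close> for all
    \<open>K\<close> near \<open>K0\<close>. There \<open>g\<close> gives stabilizing solutions,
    which \<open>XK_eqI\<close> identifies with \<open>XK\<close>.\<close>
  have "f (X0, K0) \<in> interior (f ` S)"
    using sussmann_open_mapping[OF openS contf p0 derf g' order_refl] p0 openS by (simp add: interior_open)
  then have int: "(0, K0) \<in> interior (f ` S)" by (simp add: fp0)
  have ev: "\<forall>\<^sub>F K in nhds K0. (0, K) \<in> f ` S"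
  proof -
    have "((\<lambda>K. (0, K)) \<longlongrightarrow> (0 :: real^'n^'n, K0)) (nhds K0)"
      by (intro tendsto_intros filterlim_ident)
    then have "\<forall>\<^sub>F K in nhds K0. (0, K) \<in> interior (f ` S)"
      using int by (rule topological_tendstoD[OF _ open_interior])
    then show ?thesis by (rule eventually_mono) (use interior_subset in blast)
  qed
  have eq: "riccati A B Bw Q R e (XK A B Bw Q R \<beta> K) K = 0 \<and> XK A B Bw Q R \<beta> K = fst (g (0, K))"
    if "(0, K) \<in> f ` S" for K
  proof -
    obtain p where p: "p \<in> S" "f p = (0, K)" using \<open>(0, K) \<in> f ` S\<close> by auto
    then have snd: "snd p = K" and ric: "riccati A B Bw Q R e (fst p) K = 0" by (auto simp: f_def)
    have "XK A B Bw Q R \<beta> K = fst p"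
      using p(1) snd ric by (intro XK_eqI[OF Q R]) (auto simp: S_def e_def)
    with ric gf[OF p(1)] p(2) show ?thesis by simp
  qed
  show "\<forall>\<^sub>F K in nhds K0. riccati A B Bw Q R (inverse (\<beta>\<^sup>2)) (XK A B Bw Q R \<beta> K) K = 0"
    using ev by (rule eventually_mono) (fold e_def, use eq in blast)
  have evX: "\<forall>\<^sub>F K in nhds K0. fst (g (0, K)) = XK A B Bw Q R \<beta> K"
    using ev by (rule eventually_mono) (use eq in simp)
  have "(XK A B Bw Q R \<beta> has_derivative (\<lambda>h. fst (g' (0, h)))) (at K0)"
    using evX by (intro has_derivative_transform_eventually[OF derg])
      (auto intro: eventually_nhds_x_imp_x[OF evX] simp: eventually_at_filter elim: eventually_mono)
  then show "\<exists>X'. (XK A B Bw Q R \<beta> has_derivative X') (at K0)" by blast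
qed

subsection \<open>Stationary points\<close>

definition adjoint_residual where
  "adjoint_residual A B Q R Q2 R2 e X Y K =
     transpose (Acl A B Q R e X K) ** Y + Y ** Acl A B Q R e X K + (Q2 + transpose K ** R2 ** K)"

definition gain_residual where
  "gain_residual B R R2 e X Y K = R2 ** K + transpose B ** Y + e *\<^sub>R (R ** K ** X ** Y)"

lemma trace_scaleR: "trace (c *\<^sub>R M) = c * trace M" for M :: "real^'n^'n"
  by (simp add: trace_def sum_distrib_left)

lemma trace_zero: "trace (0 :: real^'n^'n) = 0"
  by (simp add: trace_def)

text \<open>The left-hand side is the derivative, in direction \<open>(U, H)\<close>, of the Lagrangian
  \<open>trace ((Q2 + K\<^sup>T R2 K) X) + trace (Y riccati(X, K))\<close>, which is \<open>Jmix\<close> along \<open>X = XK K\<close>.\<close>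

lemma lagrangian_derivative_zero:
  fixes X Y :: "real^'n^'n" and K :: "real^'n^'m"
  assumes sym: "transpose Q = Q" "transpose R = R" "transpose R2 = R2" "transpose X = X" "transpose Y = Y"
    and adj: "adjoint_residual A B Q R Q2 R2 e X Y K = 0"
    and gain: "gain_residual B R R2 e X Y K = 0"
  shows "trace ((Q2 + transpose K ** R2 ** K) ** U + (transpose H ** R2 ** K + transpose K ** R2 ** H) ** X)
    + trace (Y ** (AK A B K ** U + B ** H ** X + U ** transpose (AK A B K) + X ** transpose (B ** H)
      + e *\<^sub>R (U ** SK Q R K ** X + X ** (transpose H ** R ** K + transpose K ** R ** H) ** X
        + X ** SK Q R K ** U))) = 0"
proof -
  let ?A = "AK A B K" and ?S = "SK Q R K" and ?M = "Q2 + transpose K ** R2 ** K"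
  \<comment> \<open>Variation in \<open>X\<close>: cyclicity of the trace moves \<open>U\<close> to
    the right end of every term and assembles the adjoint residual.\<close>
  have U: "trace (?M ** U) + trace (Y ** ?A ** U) + trace (Y ** U ** transpose ?A)
      + e * trace (Y ** U ** ?S ** X) + e * trace (Y ** X ** ?S ** U)
      = trace (adjoint_residual A B Q R Q2 R2 e X Y K ** U)"
  proof -
    have "trace (Y ** U ** transpose ?A) = trace (transpose ?A ** Y ** U)"
      by (simp only: trace_mul_sym[of "Y ** U"] matrix_mul_assoc)
    moreover have "trace (Y ** U ** ?S ** X) = trace (?S ** X ** Y ** U)"
      using trace_mul_sym[of "Y ** U" "?S ** X"] by (simp only: matrix_mul_assoc)
    ultimately show ?thesis
      by (simp add: adjoint_residual_def transpose_distribs transpose_SK sym Acl_def matrix_distribs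
          trace_add trace_scaleR
          matrix_scalar_ac scalar_matrix_assoc[symmetric] matrix_mul_assoc)
  qed
  \<comment> \<open>Variation in \<open>K\<close>: every term becomes a pairing of \<open>H\<close>
    with a matrix ending in \<open>X\<close>. Transposition identifies the terms in \<open>H\<close>
    with those in \<open>transpose H\<close>, hence the factor 2.\<close>
  define T where "T Z = trace (transpose H ** Z)" for Z :: "real^'n^'m"
  have h1: "trace (transpose H ** R2 ** K ** X) = T (R2 ** K ** X)"
    by (simp add: T_def matrix_mul_assoc)
  have h2: "trace (transpose K ** R2 ** H ** X) = T (R2 ** K ** X)"
  proof -
    have "trace (transpose K ** R2 ** H ** X) = trace (transpose (transpose K ** R2 ** H ** X))"
      by (simp only: trace_transpose)
    also have "\<dots> = trace (X ** (transpose H ** R2 ** K))"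
      by (simp add: transpose_distribs sym matrix_mul_assoc)
    finally show ?thesis by (subst (asm) trace_mul_sym[of X]) (simp add: T_def matrix_mul_assoc)
  qed
  have h3: "trace (Y ** X ** transpose H ** transpose B) = T (transpose B ** Y ** X)"
    using trace_mul_sym[of "Y ** X" "transpose H ** transpose B"] by (simp add: T_def matrix_mul_assoc)
  have h4: "trace (Y ** B ** H ** X) = T (transpose B ** Y ** X)"
  proof -
    have "trace (Y ** B ** H ** X) = trace (transpose (Y ** B ** H ** X))"
      by (simp only: trace_transpose)
    also have "\<dots> = trace (X ** (transpose H ** transpose B ** Y))"
      by (simp add: transpose_distribs sym matrix_mul_assoc)
    finally show ?thesis by (subst (asm) trace_mul_sym[of X]) (simp add: T_def matrix_mul_assoc)
  qed
  have h5: "trace (Y ** X ** transpose H ** R ** K ** X) = T (R ** K ** X ** Y ** X)"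
    using trace_mul_sym[of "Y ** X" "transpose H ** R ** K ** X"] by (simp add: T_def matrix_mul_assoc)
  have h6: "trace (Y ** X ** transpose K ** R ** H ** X) = T (R ** K ** X ** Y ** X)"
  proof -
    have "trace (Y ** X ** transpose K ** R ** H ** X) = trace (transpose (Y ** X ** transpose K ** R ** H ** X))"
      by (simp only: trace_transpose)
    also have "\<dots> = trace (X ** (transpose H ** R ** K ** X ** Y))"
      by (simp add: transpose_distribs sym matrix_mul_assoc)
    finally show ?thesis by (subst (asm) trace_mul_sym[of X]) (simp add: T_def matrix_mul_assoc)
  qed
  have G: "T (gain_residual B R R2 e X Y K ** X) = T (R2 ** K ** X) + T (transpose B ** Y ** X) + e * T (R ** K ** X ** Y ** X)"
    by (simp add: gain_residual_def T_def matrix_distribs trace_add trace_scaleR matrix_scalar_ac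
        scalar_matrix_assoc[symmetric])
  have "trace (?M ** U + (transpose H ** R2 ** K + transpose K ** R2 ** H) ** X)
    + trace (Y ** (?A ** U + B ** H ** X + U ** transpose ?A + X ** transpose (B ** H)
      + e *\<^sub>R (U ** ?S ** X + X ** (transpose H ** R ** K + transpose K ** R ** H) ** X
        + X ** ?S ** U)))
    = (trace (?M ** U) + trace (Y ** ?A ** U) + trace (Y ** U ** transpose ?A)
      + e * trace (Y ** U ** ?S ** X) + e * trace (Y ** X ** ?S ** U))
      + (trace (transpose H ** R2 ** K ** X) + trace (transpose K ** R2 ** H ** X)
      + trace (Y ** X ** transpose H ** transpose B) + trace (Y ** B ** H ** X)
      + e * (trace (Y ** X ** transpose H ** R ** K ** X) + trace (Y ** X ** transpose K ** R ** H ** X)))"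
    by (simp add: matrix_add_ldistrib matrix_add_rdist transpose_distribs trace_add trace_scaleR
        matrix_scalar_ac scalar_matrix_assoc[symmetric] matrix_mul_assoc algebra_simps)
  also have "\<dots> = 2 * T (gain_residual B R R2 e X Y K ** X)"
    unfolding U h1 h2 h3 h4 h5 h6 G adj by (simp add: trace_zero)
  also have "\<dots> = 0" by (simp add: gain T_def trace_zero)
  finally show ?thesis .
qed

text \<open>The multiplier term trace (Y riccati) vanishes along \<open>XK\<close>, and its
  derivative cancels the contribution of the unknown derivative of \<open>XK\<close>.\<close>

lemma Jmix_stationary:
  fixes A :: "real^'n^'n" and B :: "real^'m^'n" and K0 :: "real^'n^'m"
  assumes Q: "pd Q" and R: "pd R" and Q2: "transpose Q2 = Q2" and R2: "transpose R2 = R2"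
    and hA: "hurwitz (AK A B K0)"
    and hX: "hurwitz (Acl A B Q R (inverse (\<beta>\<^sup>2)) X0 K0)"
    and X0: "riccati A B Bw Q R (inverse (\<beta>\<^sup>2)) X0 K0 = 0"
    and adj: "adjoint_residual A B Q R Q2 R2 (inverse (\<beta>\<^sup>2)) X0 Y K0 = 0"
    and gain: "gain_residual B R R2 (inverse (\<beta>\<^sup>2)) X0 Y K0 = 0"
  shows "(Jmix A B Bw Q2 R2 Q R \<beta> has_derivative (\<lambda>H. 0)) (at K0)"
proof -
  define e where "e = inverse (\<beta>\<^sup>2)"
  note hX' = hX[folded e_def] and X0' = X0[folded e_def] and adj' = adj[folded e_def] and gain' = gain[folded e_def]
  have sym: "transpose Q = Q" "transpose R = R" using Q R by (auto simp: pd_def)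
  have symX: "transpose X0 = X0"
    using stabilizing_solution_psd[OF Q R _ hA hX' X0'] by (simp add: e_def psd_def)
  have symY: "transpose Y = Y"
  proof -
    let ?M = "Acl A B Q R e X0 K0"
    have "transpose (adjoint_residual A B Q R Q2 R2 e X0 Y K0) = adjoint_residual A B Q R Q2 R2 e X0 (transpose Y) K0"
      by (simp add: adjoint_residual_def transpose_distribs Q2 R2 matrix_mul_assoc add.commute)
    then have Yt: "adjoint_residual A B Q R Q2 R2 e X0 (transpose Y) K0 = 0"
      using adj' by (simp add: transpose_zero)
    have "transpose ?M ** (Y - transpose Y) + (Y - transpose Y) ** ?M =
        adjoint_residual A B Q R Q2 R2 e X0 Y K0 - adjoint_residual A B Q R Q2 R2 e X0 (transpose Y) K0"
      unfolding adjoint_residual_def matrix_diff_ldist matrix_diff_rdist by simp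
    then have "transpose ?M ** (Y - transpose Y) + (Y - transpose Y) ** ?M = 0"
      using Yt adj' by simp
    then have "Y - transpose Y = 0"
      using sylvester_unique hX' hurwitz_transpose by blast
    then show ?thesis by simp
  qed
  let ?X = "XK A B Bw Q R \<beta>"
  obtain X' where X': "(?X has_derivative X') (at K0)"
    using XK_differentiable(1)[OF Q R hA hX X0] by blast
  have XK0: "?X K0 = X0" using XK_eqI[OF Q R hA hX X0] .
  define L where "L K = trace ((Q2 + transpose K ** R2 ** K) ** ?X K) + trace (Y ** riccati A B Bw Q R e (?X K) K)" for K
  note ric = riccati_has_derivative[where A = A and B = B and Bw = Bw and Q = Q and R = R,
      OF has_derivative_const[of e] X' has_derivative_ident, unfolded XK0]
  have "(L has_derivative (\<lambda>H. trace ((Q2 + transpose K0 ** R2 ** K0) ** X' H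
        + (transpose H ** R2 ** K0 + transpose K0 ** R2 ** H) ** X0)
      + trace (Y ** (AK A B K0 ** X' H + B ** H ** X0 + X' H ** transpose (AK A B K0) + X0 ** transpose (B ** H)
      + e *\<^sub>R (X' H ** SK Q R K0 ** X0 + X0 ** (transpose H ** R ** K0 + transpose K0 ** R ** H) ** X0
        + X0 ** SK Q R K0 ** X' H)))) ) (at K0)"
    unfolding L_def
    by (rule derivative_eq_intros X' ric refl)+ (simp add: fun_eq_iff XK0 matrix_distribs add_ac)
  then have derL: "(L has_derivative (\<lambda>H. 0)) (at K0)"
    unfolding lagrangian_derivative_zero[OF sym R2 symX symY adj' gain'] .
  \<comment> \<open>The multiplier term is known to vanish only near \<open>K0\<close>, where
    \<open>XK\<close> solves the Riccati equation; this determines the derivative at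
    \<open>K0\<close>.\<close>
  have ev: "\<forall>\<^sub>F K in nhds K0. L K = Jmix A B Bw Q2 R2 Q R \<beta> K"
    using XK_differentiable(2)[OF Q R hA hX X0]
    by (rule eventually_mono) (simp add: L_def Jmix_def e_def trace_zero)
  have "\<forall>\<^sub>F K in at K0. L K = Jmix A B Bw Q2 R2 Q R \<beta> K"
    using ev unfolding eventually_at_filter by (rule eventually_mono) simp
  then show ?thesis
    using eventually_nhds_x_imp_x[OF ev] by (rule has_derivative_transform_eventually[OF derL]) simp
qed

text \<open>At \<open>e = 0\<close> the linearised system is block triangular: the LQR condition \<open>gain\<close> cancels the
  \<open>K\<close>-derivative of the adjoint equation.\<close>

lemma optimality_system_solvable:
  fixes A :: "real^'n^'n" and B :: "real^'m^'n" and Ks :: "real^'n^'m"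
  assumes R2: "pd R2" and symQ: "transpose Q = Q" "transpose R = R" and "0 < \<delta>"
    and hA: "hurwitz (AK A B Ks)"
    and Y: "transpose Ys = Ys" "transpose (AK A B Ks) ** Ys + Ys ** AK A B Ks = - (Q2 + transpose Ks ** R2 ** Ks)"
    and gain: "R2 ** Ks + transpose B ** Ys = 0"
  obtains r where "r > 0"
    "\<And>e. \<bar>e\<bar> < r \<Longrightarrow> \<exists>X Y K. dist K Ks < \<delta> \<and> hurwitz (AK A B K) \<and> hurwitz (Acl A B Q R e X K) \<and>
       riccati A B Bw Q R e X K = 0 \<and> adjoint_residual A B Q R Q2 R2 e X Y K = 0 \<and> gain_residual B R R2 e X Y K = 0"
proof -
  let ?A = "AK A B Ks"
  \<comment> \<open>At e = 0 the Riccati equation becomes linear; \<open>Xs\<close> is the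
    controllability Gramian of the LQR loop.\<close>
  have "transpose (Bw ** transpose Bw) = Bw ** transpose Bw" by (simp add: transpose_distribs)
  then obtain Xs where Xs: "transpose Xs = Xs" "?A ** Xs + Xs ** transpose ?A = - (Bw ** transpose Bw)"
    using lyapunov_equation_solvable[of "transpose ?A" "Bw ** transpose Bw"] hA by auto
  define X where "X p = fst p" for p :: "(real^'n^'n) \<times> (real^'n^'n) \<times> (real^'n^'m) \<times> real"
  define Y where "Y p = fst (snd p)" for p :: "(real^'n^'n) \<times> (real^'n^'n) \<times> (real^'n^'m) \<times> real"
  define K where "K p = fst (snd (snd p))" for p :: "(real^'n^'n) \<times> (real^'n^'n) \<times> (real^'n^'m) \<times> real"
  define e where "e p = snd (snd (snd p))" for p :: "(real^'n^'n) \<times> (real^'n^'n) \<times> (real^'n^'m) \<times> real"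
  have cont [continuous_intros]: "continuous_on T X" "continuous_on T Y" "continuous_on T K" "continuous_on T e" for T
    unfolding X_def Y_def K_def e_def by (intro continuous_intros)+
  have der: "(X has_derivative X) (at p)" "(Y has_derivative Y) (at p)" "(K has_derivative K) (at p)" "(e has_derivative e) (at p)" for p
    unfolding X_def Y_def K_def e_def by (auto intro!: derivative_eq_intros)
  \<comment> \<open>Carrying \<open>e\<close> both as unknown and as output makes domain and
    codomain agree, and one neighbourhood of 0 in the image covers all small values of
    \<open>e\<close> at once.\<close>
  define F where "F p = (riccati A B Bw Q R (e p) (X p) (K p),
      adjoint_residual A B Q R Q2 R2 (e p) (X p) (Y p) (K p),
      gain_residual B R R2 (e p) (X p) (Y p) (K p), e p)" for p
  define p0 where "p0 = (Xs, Ys, Ks, 0::real)"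
  have p0: "X p0 = Xs" "Y p0 = Ys" "K p0 = Ks" "e p0 = 0"
    by (simp_all add: p0_def X_def Y_def K_def e_def)
  have contF: "continuous_on UNIV F"
    unfolding F_def riccati_def adjoint_residual_def gain_residual_def Acl_def
    by (intro continuous_intros)
  define D where "D h = B ** K h + e h *\<^sub>R (Xs ** SK Q R Ks)" for h
  define F' where "F' h = (?A ** X h + B ** K h ** Xs + X h ** transpose ?A + Xs ** transpose (B ** K h)
        + e h *\<^sub>R (Xs ** SK Q R Ks ** Xs),
      transpose (D h) ** Ys + transpose ?A ** Y h + Y h ** ?A + Ys ** D h
        + (transpose (K h) ** R2 ** Ks + transpose Ks ** R2 ** K h),
      R2 ** K h + transpose B ** Y h + e h *\<^sub>R (R ** Ks ** Xs ** Ys), e h)" for h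
  have derF: "(F has_derivative F') (at p0)"
    unfolding F_def F'_def
  proof (intro has_derivative_Pair der)
    note Acl_der = Acl_has_derivative[where p = p0 and A = A and B = B and Q = Q and R = R,
        OF der(4) der(1) der(3)]
    show "((\<lambda>p. riccati A B Bw Q R (e p) (X p) (K p)) has_derivative
       (\<lambda>h. ?A ** X h + B ** K h ** Xs + X h ** transpose ?A + Xs ** transpose (B ** K h)
        + e h *\<^sub>R (Xs ** SK Q R Ks ** Xs))) (at p0)"
      using riccati_has_derivative[where p = p0 and A = A and B = B and Bw = Bw and Q = Q and R = R,
        OF der(4) der(1) der(3)] by (simp add: p0)
    show "((\<lambda>p. adjoint_residual A B Q R Q2 R2 (e p) (X p) (Y p) (K p)) has_derivative
       (\<lambda>h. transpose (D h) ** Ys + transpose ?A ** Y h + Y h ** ?A + Ys ** D h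
        + (transpose (K h) ** R2 ** Ks + transpose Ks ** R2 ** K h))) (at p0)"
      unfolding adjoint_residual_def
      by (rule derivative_eq_intros Acl_der der refl)+
        (simp add: fun_eq_iff p0 D_def Acl_def algebra_simps)
    show "((\<lambda>p. gain_residual B R R2 (e p) (X p) (Y p) (K p)) has_derivative
       (\<lambda>h. R2 ** K h + transpose B ** Y h + e h *\<^sub>R (R ** Ks ** Xs ** Ys))) (at p0)"
      unfolding gain_residual_def
      by (rule derivative_eq_intros der refl)+ (simp add: fun_eq_iff p0)
  qed
  have Fp0: "F p0 = 0"
    using Xs(2) Y(2) gain by (simp add: F_def p0 riccati_def adjoint_residual_def gain_residual_def Acl_def zero_prod_def)
  have "h = 0" if "F' h = 0" for h
  proof -
    have e: "e h = 0" using that by (simp add: F'_def zero_prod_def)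
    have gain': "transpose Ks ** R2 = - (Ys ** B)"
      using arg_cong[OF gain, of transpose] R2 Y(1)
      by (simp add: pd_def transpose_distribs eq_neg_iff_add_eq_0)
    have "transpose B ** Ys = - (R2 ** Ks)"
      using gain by (simp add: eq_neg_iff_add_eq_0 add.commute)
    then have c1: "transpose (D h) ** Ys = - (transpose (K h) ** R2 ** Ks)"
      by (simp add: D_def e transpose_distribs matrix_distribs flip: matrix_mul_assoc)
    have c2: "transpose Ks ** R2 ** K h = - (Ys ** D h)"
      by (simp add: D_def e gain' matrix_distribs matrix_mul_assoc)
    have "transpose ?A ** Y h + Y h ** ?A = 0"
      using that unfolding F'_def zero_prod_def prod.inject c1 c2 by simp
    then have Y0: "Y h = 0"
      using sylvester_unique hA hurwitz_transpose by blast
    then have "R2 ** K h = 0"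
      using that e by (simp add: F'_def zero_prod_def)
    then have K0: "K h = 0"
      using pd_invertible[OF R2] by (metis matrix_mul_assoc matrix_mul_lid times0_right)
    then have "?A ** X h + X h ** transpose ?A = 0"
      using that e by (simp add: F'_def zero_prod_def transpose_zero)
    then have "X h = 0"
      using sylvester_unique hA hurwitz_transpose by blast
    with e Y0 K0 show ?thesis
      by (simp add: X_def Y_def K_def e_def prod_eq_iff)
  qed
  then obtain g where g: "bounded_linear g" "F' \<circ> g = id"
    using linear_injective_right_inverse has_derivative_linear[OF derF] by blast
  \<comment> \<open>The side conditions are open and hold at \<open>p0\<close>, where
    \<open>e\<close> is 0. Taking the image of \<open>T\<close> alone makes them hold for every
    solution found.\<close>
  define T where "T = K -` ball Ks \<delta> \<inter> (\<lambda>p. AK A B (K p)) -` {M. hurwitz M} \<inter>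
     (\<lambda>p. Acl A B Q R (e p) (X p) (K p)) -` {M. hurwitz M}"
  have openT: "open T"
    unfolding T_def Acl_def by (intro open_Int open_vimage open_hurwitz open_ball continuous_intros)
  have "p0 \<in> T" using \<open>0 < \<delta>\<close> hA by (simp add: T_def p0 Acl_def)
  then have "F p0 \<in> interior (F ` T)"
    using openT by (intro sussmann_open_mapping[OF open_UNIV contF _ derF g]) (simp_all add: interior_open)
  then obtain r where r: "r > 0" "ball 0 r \<subseteq> F ` T"
    unfolding Fp0 mem_interior by blast
  show thesis
  proof (rule that[OF r(1)])
    fix \<epsilon> :: real assume "\<bar>\<epsilon>\<bar> < r"
    then have "(0, 0, 0, \<epsilon>) \<in> F ` T"
      using r(2) by (intro subsetD[OF r(2)]) (simp add: norm_Pair)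
    then obtain p where p: "p \<in> T" "F p = (0, 0, 0, \<epsilon>)" by auto
    then show "\<exists>X Y K. dist K Ks < \<delta> \<and> hurwitz (AK A B K) \<and> hurwitz (Acl A B Q R \<epsilon> X K) \<and>
       riccati A B Bw Q R \<epsilon> X K = 0 \<and> adjoint_residual A B Q R Q2 R2 \<epsilon> X Y K = 0 \<and> gain_residual B R R2 \<epsilon> X Y K = 0"
      by (intro exI[of _ "X p"] exI[of _ "Y p"] exI[of _ "K p"]) (auto simp: F_def T_def dist_commute)
  qed
qed

theorem theorem4:
  fixes A :: "real^'n^'n" and B :: "real^'m^'n" and Bw :: "real^'n^'n"
    and Q2 :: "real^'n^'n" and R2 :: "real^'m^'m"
    and Qinf :: "real^'n^'n" and Rinf :: "real^'m^'m"
  assumes "psd Q2" and "pd R2" and "pd Qinf" and "pd Rinf"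
    and "stabilizable A B"
    and "detectable (psd_sqrt Q2) A"
  shows "\<exists>\<beta>bar > 0. \<forall>\<beta> > \<beta>bar.
           \<beta> > (INF K \<in> stabilizing A B. hinf_norm A B Bw Qinf Rinf K) \<longrightarrow>
           (\<exists>K \<in> Kbeta A B Bw Qinf Rinf \<beta>.
              (Jmix A B Bw Q2 R2 Qinf Rinf \<beta> has_derivative (\<lambda>H. 0)) (at K))"
proof -
  have sym: "transpose Qinf = Qinf" "transpose Rinf = Rinf" "transpose Q2 = Q2" "transpose R2 = R2"
    using assms by (auto simp: pd_def psd_def)
  obtain Ks P where P: "psd P" and hur: "hurwitz (AK A B Ks)" and gain: "R2 ** Ks + transpose B ** P = 0"
    and lyap: "transpose (AK A B Ks) ** P + P ** AK A B Ks = - (Q2 + transpose Ks ** R2 ** Ks)"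
    using lqr_solution[OF assms(1,2) detectable_undetected_stable[OF assms(1,6)] assms(5)]
    unfolding AK_def by metis
  have symP: "transpose P = P" using P by (simp add: psd_def)
  obtain \<delta> h where \<delta>: "\<delta> > 0"
    "\<And>K. dist K Ks < \<delta> \<Longrightarrow> hurwitz (AK A B K) \<Longrightarrow> hinf_norm A B Bw Qinf Rinf K \<le> h"
    using hinf_norm_locally_bounded[OF hur] by metis
  obtain r where r: "r > 0"
    "\<And>e. \<bar>e\<bar> < r \<Longrightarrow> \<exists>X Y K. dist K Ks < \<delta> \<and> hurwitz (AK A B K) \<and> hurwitz (Acl A B Qinf Rinf e X K) \<and>
       riccati A B Bw Qinf Rinf e X K = 0 \<and> adjoint_residual A B Qinf Rinf Q2 R2 e X Y K = 0 \<and>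
       gain_residual B Rinf R2 e X Y K = 0"
    using optimality_system_solvable[OF assms(2) sym(1,2) \<delta>(1) hur symP lyap gain] by blast
  \<comment> \<open>\<open>h\<close> bounds the H-infinity norm. Above 1, squaring increases
    \<beta>, so \<beta> > 1/r already gives \<open>inverse (\<beta>\<^sup>2) < r\<close>.\<close>
  define \<beta>bar where "\<beta>bar = max 1 (max h (1 / r))"
  show ?thesis
  proof (intro exI[of _ \<beta>bar] conjI allI impI)
    show "\<beta>bar > 0" by (simp add: \<beta>bar_def)
    fix \<beta> assume "\<beta> > \<beta>bar"
    then have \<beta>: "1 < \<beta>" "h < \<beta>" "1 / r < \<beta>" by (auto simp: \<beta>bar_def)
    have "\<beta> * 1 < \<beta> * \<beta>"
      using \<beta>(1) by (intro mult_strict_left_mono) auto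
    with \<beta>(3) have "1 / r < \<beta>\<^sup>2" by (simp add: power2_eq_square)
    then have "\<bar>inverse (\<beta>\<^sup>2)\<bar> < r"
      using r(1) \<beta>(1) by (simp add: field_simps)
    from r(2)[OF this] obtain X Y K where K: "dist K Ks < \<delta>" "hurwitz (AK A B K)"
      "hurwitz (Acl A B Qinf Rinf (inverse (\<beta>\<^sup>2)) X K)" "riccati A B Bw Qinf Rinf (inverse (\<beta>\<^sup>2)) X K = 0"
      "adjoint_residual A B Qinf Rinf Q2 R2 (inverse (\<beta>\<^sup>2)) X Y K = 0"
      "gain_residual B Rinf R2 (inverse (\<beta>\<^sup>2)) X Y K = 0" by blast
    show "\<exists>K \<in> Kbeta A B Bw Qinf Rinf \<beta>.
              (Jmix A B Bw Q2 R2 Qinf Rinf \<beta> has_derivative (\<lambda>H. 0)) (at K)"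
    proof
      show "(Jmix A B Bw Q2 R2 Qinf Rinf \<beta> has_derivative (\<lambda>H. 0)) (at K)"
        using Jmix_stationary[OF assms(3,4) sym(3,4) K(2-6)] .
      show "K \<in> Kbeta A B Bw Qinf Rinf \<beta>"
        using \<delta>(2)[OF K(1,2)] \<beta>(2) K(2) by (simp add: Kbeta_def stabilizing_def)
    qed
  qed
qed

end
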